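(* Assume $f$ is convex and let $\gamma^*$ be a solution of the problem $\min\{f(\gamma):\gamma\in\overline\Gamma^*,\ \langle\mathbf a_i,\gamma\rangle\le b_i\ \forall i\}$. Let $T>1$ be an integer, run the algorithm described in the context with $V=T^{1/3}$ and $\eta=T^{-2/3}$, and let $\overline x_T:=\frac1T\sum_{t=0}^{T-1}x_t$. Then $$\mathbb E[f(\overline x_T)]\le f(\gamma^* )+\Big(2K+MD+\frac{B^2}{2}+\frac{LD^2}{2T^{1/3}}\Big)\frac1{T^{1/3}},$$ $$\langle\mathbf a_i,\mathbb E[\overline x_T]\rangle-b_i\le\sqrt{4K+\frac{4K}{T^{1/3}}+\frac{B^2}{T^{1/3}}+\frac{LD^2}{T^{2/3}}}\;\frac1{T^{1/3}},\qquad\forall i\in\{1,\dots,N\},$$ and the objective bound also holds with $f(\mathbb E[\overline x_T])$ in place of $\mathbb E[f(\overline x_T)]$. Thus the convergence time to $\varepsilon$-near optimality is $\mathcal O(1/\varepsilon^3)$: there is a constant $C$ depending only on $K,M,D,B,L$ such that for every $\varepsilon\in(0,1]$ and every integer $T>1$ with $T\ge C/\varepsilon^3$, the point $\mathbb E[\overline x_T]$ is an $\varepsilon$-near optimal solution.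
   Context: Setting. Let $m,d,N\ge1$ be integers, $\langle\cdot,\cdot\rangle$ the dot product, $\|\cdot\|$ the Euclidean norm; vector inequalities are entrywise. $\mathcal B\subseteq\mathbb R^d$ is compact and convex. $\{S[t]\}_{t\ge0}$ is an i.i.d. sequence of random vectors with values in a set $\mathcal S\subseteq\mathbb R^m$. For each $s\in\mathcal S$, $\mathcal X_s\subseteq\mathcal B$ is a (nonempty) compact set, the decision options when the state is $s$. At each slot $t\in\{0,1,2,\dots\}$ the controller observes $S[t]$ and chooses $x_t\in\mathcal X_{S[t]}$. The history $\mathcal H_t$ consists of $S[0],\dots,S[t-1],x_0,\dots,x_{t-1}$. A randomized stationary algorithm chooses $x_t\in\mathcal X_{S[t]}$ as a stationary randomized function of $S[t]$ (the same conditional distribution given the same value of $S[t]$), independently of $\mathcal H_t$. $\Gamma^*\subseteq\mathbb R^d$ is the set of all expectations $\mathbb E[x_t]$ achievable at a slot by randomized stationary algorithms, and $\overline\Gamma^*$ is its closure; $\overline\Gamma^*$ is a convex subset of $\mathcal B$. Assume $0\in\overline\Gamma^*$. Given $\mathbf a_1,\dots,\mathbf a_N\in\mathbb R^d$ and $b_1,\dots,b_N\in\mathbb R$, put $\mathbf A=[\mathbf a_1,\dots,\mathbf a_N]^T$, $\mathbf b=[b_1,\dots,b_N]^T$. The problem is to minimize $f(\gamma)$ subject to $\gamma\in\overline\Gamma^*$ and $\mathbf A\gamma\le\mathbf b$, assumed feasible. Assumptions on $f$. $f:\mathcal B\to\mathbb R$ is differentiable with $\|\nabla f(x)-\nabla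 f(y)\|\le L\|x-y\|$ for all $x,y\in\mathcal B$, and there are constants with $\sup_{\gamma\in\mathcal B}\|\nabla f(\gamma)\|\le M$, $\sup_{\gamma\in\mathcal B}|f(\gamma)|\le K$, $\sup_{\gamma\in\mathcal B}\sum_{i=1}^N|\langle\mathbf a_i,\gamma\rangle-b_i|^2\le B^2$, and $\|x-y\|\le D$ for all $x,y\in\mathcal B$. Algorithm (parameters $V>0$, $0<\eta<1$). Set $\gamma_{-1}=0$ and $Q_i(0)=0$ for all $i$; $\mathbf Q(t)=[Q_1(t),\dots,Q_N(t)]$. At each slot $t=0,1,2,\dots$: (1) observe $S[t]$ and choose $x_t\in\mathcal X_{S[t]}$ minimizing $V\langle\nabla f(\gamma_{t-1}),x\rangle+\sum_{i=1}^NQ_i(t)\langle\mathbf a_i,x\rangle$ over $x\in\mathcal X_{S[t]}$ ($x_t$ is determined, measurably, by $\gamma_{t-1},\mathbf Q(t),S[t]$); (2) set $\gamma_t=(1-\eta)\gamma_{t-1}+\eta x_t$ and $Q_i(t+1)=\max\{Q_i(t)+\langle\mathbf a_i,x_t\rangle-b_i,0\}$ for all $i$. Definition. With $\gamma^*$ a solution of the problem, a point $\gamma\in\overline\Gamma^*$ is $\varepsilon$-near optimal if $f(\gamma)\le f(\gamma^* )+\varepsilon$ and $\langle\mathbf a_i,\gamma\rangle-b_i\le\varepsilon$ for all $i$. *)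

theory Defs
  imports "HOL-Probability.Probability"
begin

text \<open>
  A randomized stationary algorithm is a Markov kernel \<open>\<kappa>\<close>: in state \<open>s\<close> the decision is drawn
  from \<open>\<kappa> s\<close>, independently of the history. The set \<open>SS\<close> of states need not be Borel, so kernels
  (and decision rules below) are measurable for the trace of the Borel sigma-algebra on \<open>SS\<close>.
\<close>

definition randomized_stationary ::
  "'s::topological_space set \<Rightarrow> ('s \<Rightarrow> 'v::topological_space set) \<Rightarrow> ('s \<Rightarrow> 'v measure) \<Rightarrow> bool" where
  "randomized_stationary SS X \<kappa> \<longleftrightarrow>
     \<kappa> \<in> restrict_space borel SS \<rightarrow>\<^sub>M prob_algebra borel \<and>
     (\<forall>s\<in>SS. AE y in \<kappa> s. y \<in> X s)"

text \<open>
  The measure \<open>P \<bind> (\<lambda>\<omega>. \<kappa> (S t \<omega>))\<close> is the law of the decision taken at slot \<open>t\<close> under \<open>\<kappa>\<close>,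
  so its mean is the expected decision.
\<close>

definition achievable_means ::
  "'w measure \<Rightarrow> (nat \<Rightarrow> 'w \<Rightarrow> 's::topological_space) \<Rightarrow> 's set \<Rightarrow>
   ('s \<Rightarrow> 'v::euclidean_space set) \<Rightarrow> 'v set" where
  "achievable_means P S SS X =
     {\<integral>y. y \<partial>(P \<bind> (\<lambda>\<omega>. \<kappa> (S t \<omega>))) | \<kappa> t. randomized_stationary SS X \<kappa>}"

text \<open>
  Indices of the averaged decisions are shifted by one: \<open>gamma_prev \<eta> x t\<close> is $\gamma_{t-1}$,
  so that the value at 0 is $\gamma_{-1} = 0$.
\<close>

primrec gamma_prev :: "real \<Rightarrow> (nat \<Rightarrow> 'v::real_vector) \<Rightarrow> nat \<Rightarrow> 'v" where
  "gamma_prev \<eta> x 0 = 0"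
| "gamma_prev \<eta> x (Suc t) = (1 - \<eta>) *\<^sub>R gamma_prev \<eta> x t + \<eta> *\<^sub>R x t"

primrec vqueue ::
  "('n::finite \<Rightarrow> 'v::real_inner) \<Rightarrow> ('n \<Rightarrow> real) \<Rightarrow> (nat \<Rightarrow> 'v) \<Rightarrow> nat \<Rightarrow> real ^ 'n" where
  "vqueue a b x 0 = 0"
| "vqueue a b x (Suc t) = (\<chi> i. max (vqueue a b x t $ i + a i \<bullet> x t - b i) 0)"

text \<open>
  A decision rule for one slot: a measurable map from $(\gamma_{t-1}, Q(t), S[t])$ to a minimizer
  over the options available in state $S[t]$. Here \<open>g\<close> is the gradient of the objective.
\<close>

definition decision_rule ::
  "real \<Rightarrow> ('v::euclidean_space \<Rightarrow> 'v) \<Rightarrow> ('n::finite \<Rightarrow> 'v) \<Rightarrow> 'v set \<Rightarrow>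
   's::topological_space set \<Rightarrow> ('s \<Rightarrow> 'v set) \<Rightarrow> ('v \<times> (real ^ 'n) \<times> 's \<Rightarrow> 'v) \<Rightarrow> bool" where
  "decision_rule V g a BB SS X \<phi> \<longleftrightarrow>
     \<phi> \<in> borel_measurable (restrict_space borel (BB \<times> {q. \<forall>i. 0 \<le> q $ i} \<times> SS)) \<and>
     (\<forall>\<gamma>\<in>BB. \<forall>q. \<forall>s\<in>SS. (\<forall>i. 0 \<le> q $ i) \<longrightarrow>
        is_arg_min (\<lambda>y. V * (g \<gamma> \<bullet> y) + (\<Sum>i\<in>UNIV. q $ i * (a i \<bullet> y))) (\<lambda>y. y \<in> X s)
          (\<phi> (\<gamma>, q, s)))"

definition is_solution ::
  "('v::real_inner \<Rightarrow> real) \<Rightarrow> ('n \<Rightarrow> 'v) \<Rightarrow> ('n \<Rightarrow> real) \<Rightarrow> 'v set \<Rightarrow> 'v \<Rightarrow> bool" where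
  "is_solution f a b G \<gamma> \<longleftrightarrow> is_arg_min f (\<lambda>y. y \<in> G \<and> (\<forall>i. a i \<bullet> y \<le> b i)) \<gamma>"

definition near_optimal ::
  "('v::real_inner \<Rightarrow> real) \<Rightarrow> ('n \<Rightarrow> 'v) \<Rightarrow> ('n \<Rightarrow> real) \<Rightarrow> 'v set \<Rightarrow> 'v \<Rightarrow> real \<Rightarrow> 'v \<Rightarrow> bool" where
  "near_optimal f a b G \<gamma>s \<epsilon> \<gamma> \<longleftrightarrow>
     \<gamma> \<in> G \<and> f \<gamma> \<le> f \<gamma>s + \<epsilon> \<and> (\<forall>i. a i \<bullet> \<gamma> - b i \<le> \<epsilon>)"

text \<open>
  The constant in the $O(1/\varepsilon^3)$ convergence time may depend only on the five bounds
  below, not on the dimensions or the probability space. As these are types here, an existential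
  quantifier inside a theorem could not express that independence; hence a closed form. It comes
  from bounding the coefficients of $T^{-1/3}$ in the two error estimates using $T \ge 1$.
\<close>

definition conv_const :: "real \<Rightarrow> real \<Rightarrow> real \<Rightarrow> real \<Rightarrow> real \<Rightarrow> real" where
  "conv_const K M D B L =
     (max (2 * K + M * D + B\<^sup>2 / 2 + L * D\<^sup>2 / 2) (sqrt (8 * K + B\<^sup>2 + L * D\<^sup>2))) ^ 3"

end

theory Submission
  imports Defs
begin

text \<open>
  The proof separates a deterministic inequality, valid along every sample path, from a single
  probabilistic fact.

  Along a path, one adds the change of the potential \<open>(V / \<eta>) f(\<gamma>) + |Q|^2 / 2\<close> in each slot to
  \<open>V (f(\<gamma>) - f(\<gamma>*))\<close>. Smoothness of \<open>f\<close>, convexity of \<open>f\<close> and feasibility of \<open>\<gamma>*\<close> bound this sum by a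
  constant plus \<open>\<langle>w, x - \<gamma>*\<rangle>\<close>, where \<open>w = V \<nabla>f(\<gamma>) + \<Sum> Q_i a_i\<close> is precisely the vector whose inner
  product with the decision is minimized by the algorithm (\<open>drift_plus_penalty_step\<close>). The potential
  telescopes (\<open>drift_plus_penalty_sum\<close>).

  In the mean, the terms \<open>\<langle>w, x - \<gamma>*\<rangle>\<close> are nonpositive. The weight \<open>w\<close> is a function of the past states,
  hence independent of the current one; the decision beats, for this weight, whatever a randomized
  stationary algorithm would choose in the current state; and by independence the mean comparison is
  with the expected decision of that algorithm, which can be taken arbitrarily close to \<open>\<gamma>*\<close>
  (\<open>expected_weighted_decision_le\<close>).

  What remains is a bound on \<open>V \<Sum> (f(\<gamma>) - f(\<gamma>*)) + |Q(T)|^2 / 2\<close> in expectation. Dropping the second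
  term bounds the objective at the average of the \<open>\<gamma>\<close>, which differs from the average of the decisions by
  at most \<open>D / (\<eta> T)\<close>. Bounding the first term trivially controls the queues, and a queue dominates the
  accumulated violation of its constraint. With \<open>V = T^(1/3)\<close> and \<open>\<eta> = T^(-2/3)\<close> all errors are of order
  \<open>T^(-1/3)\<close>. Finally, the mean of the average decision is itself achievable: the history acts as
  randomization independent of the current state (\<open>expected_decision_achievable\<close>), and achievable
  means form a convex set (\<open>convex_achievable_means\<close>).
\<close>

section \<open>Smooth and convex functions on convex sets\<close>

text \<open>
  The set may have empty interior, so that \<open>g\<close> is only one of many possible gradients within it.
  Everything below restricts the function to segments, where the one-dimensional derivative is
  determined by any of them.
\<close>

lemma has_real_derivative_along_segment:
  fixes f :: "'v::real_inner \<Rightarrow> real"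
  assumes conv: "convex A" and x: "x \<in> A" and y: "y \<in> A"
    and deriv: "\<And>z. z \<in> A \<Longrightarrow> (f has_derivative (\<lambda>h. g z \<bullet> h)) (at z within A)"
    and s: "s \<in> {0..1}"
  shows "((\<lambda>s. f (x + s *\<^sub>R (y - x))) has_real_derivative g (x + s *\<^sub>R (y - x)) \<bullet> (y - x))
           (at s within {0..1})"
proof -
  have mem: "x + s *\<^sub>R (y - x) \<in> A" if "s \<in> {0..1}" for s
  proof -
    have "x + s *\<^sub>R (y - x) = (1 - s) *\<^sub>R x + s *\<^sub>R y" by (simp add: algebra_simps)
    then show ?thesis using convexD_alt[OF conv x y] that by simp
  qed
  have "((\<lambda>s. x + s *\<^sub>R (y - x)) has_derivative (\<lambda>h. h *\<^sub>R (y - x))) (at s within {0..1})"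
    by (auto intro!: derivative_eq_intros)
  moreover have "(f has_derivative (\<lambda>h. g (x + s *\<^sub>R (y - x)) \<bullet> h))
      (at (x + s *\<^sub>R (y - x)) within (\<lambda>s. x + s *\<^sub>R (y - x)) ` {0..1})"
    using deriv[OF mem[OF s]] by (rule has_derivative_subset) (use mem in auto)
  ultimately have "((f \<circ> (\<lambda>s. x + s *\<^sub>R (y - x))) has_derivative
      (\<lambda>h. g (x + s *\<^sub>R (y - x)) \<bullet> h) \<circ> (\<lambda>h. h *\<^sub>R (y - x))) (at s within {0..1})"
    by (rule diff_chain_within)
  moreover have "(\<lambda>h. g (x + s *\<^sub>R (y - x)) \<bullet> h) \<circ> (\<lambda>h. h *\<^sub>R (y - x))
      = (*) (g (x + s *\<^sub>R (y - x)) \<bullet> (y - x))"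
    by (simp add: fun_eq_iff)
  ultimately show ?thesis by (simp add: has_field_derivative_def o_def)
qed

text \<open>
  The function \<open>h s = f (x + s (y - x)) - s \<langle>g x, y - x\<rangle> - L s^2 |y - x|^2 / 2\<close>
  has nonpositive derivative on the unit interval, because \<open>g\<close> has moved by at most
  \<open>L s |y - x|\<close> at time \<open>s\<close>; the mean value theorem gives \<open>h 1 \<le> h 0\<close>.
\<close>

lemma smooth_upper_bound:
  fixes f :: "'v::real_inner \<Rightarrow> real"
  assumes conv: "convex A" and x: "x \<in> A" and y: "y \<in> A"
    and deriv: "\<And>z. z \<in> A \<Longrightarrow> (f has_derivative (\<lambda>h. g z \<bullet> h)) (at z within A)"
    and lip: "L-lipschitz_on A g"
  shows "f y \<le> f x + g x \<bullet> (y - x) + L / 2 * (norm (y - x))\<^sup>2"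
proof -
  define v where "v = y - x"
  define h where "h s = f (x + s *\<^sub>R v) - s * (g x \<bullet> v) - L / 2 * s\<^sup>2 * (norm v)\<^sup>2" for s
  define h' where "h' s = (g (x + s *\<^sub>R v) - g x) \<bullet> v - L * s * (norm v)\<^sup>2" for s
  have "(h has_derivative (*) (h' s)) (at s within {0..1})" if "0 \<le> s" "s \<le> 1" for s
  proof -
    have "(h has_real_derivative h' s) (at s within {0..1})"
      unfolding h_def h'_def
      using has_real_derivative_along_segment[OF conv x y deriv, where s=s, folded v_def] that
      by (auto intro!: derivative_eq_intros simp: algebra_simps)
    then show ?thesis by (simp add: has_field_derivative_def)
  qed
  from mvt_simple[of 0 1 h "\<lambda>s. (*) (h' s)", OF _ this]
  obtain s where s: "0 < s" "s < 1" "h 1 - h 0 = h' s" by auto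
  have "x + s *\<^sub>R v = (1 - s) *\<^sub>R x + s *\<^sub>R y" by (simp add: v_def algebra_simps)
  then have "x + s *\<^sub>R v \<in> A" using convexD_alt[OF conv x y] s by simp
  then have "norm (g (x + s *\<^sub>R v) - g x) \<le> L * norm (x + s *\<^sub>R v - x)"
    by (rule lipschitz_on_normD[OF lip _ x])
  then have "(g (x + s *\<^sub>R v) - g x) \<bullet> v \<le> (L * (s * norm v)) * norm v"
    using s by (intro order.trans[OF norm_cauchy_schwarz] mult_right_mono) auto
  then have "h' s \<le> 0" by (simp add: h'_def power2_eq_square)
  then show ?thesis using s by (simp add: h_def v_def)
qed

text \<open>
  Difference quotients of a convex function along a segment are bounded by the total increment;
  the derivative at the left end is their limit.
\<close>

lemma convex_above_tangent:
  fixes f :: "'v::real_inner \<Rightarrow> real"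
  assumes conv: "convex_on A f" and x: "x \<in> A" and y: "y \<in> A"
    and deriv: "\<And>z. z \<in> A \<Longrightarrow> (f has_derivative (\<lambda>h. g z \<bullet> h)) (at z within A)"
  shows "f x + g x \<bullet> (y - x) \<le> f y"
proof -
  have "((\<lambda>s. f (x + s *\<^sub>R (y - x))) has_real_derivative g x \<bullet> (y - x)) (at 0 within {0..1})"
    using has_real_derivative_along_segment[OF convex_on_imp_convex[OF conv] x y deriv, of 0] by simp
  then have lim: "((\<lambda>s. (f (x + s *\<^sub>R (y - x)) - f x) / s) \<longlongrightarrow> g x \<bullet> (y - x)) (at 0 within {0..1})"
    by (simp add: has_field_derivative_iff)
  have "eventually (\<lambda>s. (f (x + s *\<^sub>R (y - x)) - f x) / s \<le> f y - f x) (at 0 within {0..1::real})"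
  proof -
    have "(f (x + s *\<^sub>R (y - x)) - f x) / s \<le> f y - f x" if "s \<in> {0..1}" "s \<noteq> 0" for s :: real
    proof -
      have "f ((1 - s) *\<^sub>R x + s *\<^sub>R y) \<le> (1 - s) * f x + s * f y"
        using convex_onD[OF conv] that x y by auto
      moreover have "(1 - s) *\<^sub>R x + s *\<^sub>R y = x + s *\<^sub>R (y - x)" by (simp add: algebra_simps)
      ultimately have "f (x + s *\<^sub>R (y - x)) - f x \<le> (f y - f x) * s" by (simp add: algebra_simps)
      then show ?thesis using that by (simp add: pos_divide_le_eq)
    qed
    then show ?thesis by (auto simp: eventually_at_filter intro: always_eventually)
  qed
  moreover have "at 0 within {0..1::real} \<noteq> bot"
    by (simp add: at_within_Icc_at_right)
  ultimately have "g x \<bullet> (y - x) \<le> f y - f x"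
    using lim by (intro tendsto_upperbound) auto
  then show ?thesis by simp
qed

section \<open>Averaged decisions and virtual queues along one sample path\<close>

lemma gamma_prev_mem:
  assumes "convex A" "0 \<in> A" "0 \<le> \<eta>" "\<eta> \<le> 1" "\<And>k. k < t \<Longrightarrow> x k \<in> A"
  shows "gamma_prev \<eta> x t \<in> A"
  using assms(5) by (induction t) (use assms(1-4) in \<open>auto intro!: convexD_alt\<close>)

text \<open>
  Summing the recursion \<open>\<gamma>' - \<gamma> = \<eta> (x - \<gamma>)\<close>, which starts at 0: the averaged decisions and
  the decisions themselves have nearly the same time average.
\<close>

lemma sum_gamma_prev:
  "\<eta> *\<^sub>R ((\<Sum>t<T. x t) - (\<Sum>t<T. gamma_prev \<eta> x t)) = gamma_prev \<eta> x T"
  by (induction T) (simp_all add: algebra_simps)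

lemma vqueue_nonneg: "0 \<le> vqueue a b x t $ i"
  by (cases t) auto

text \<open>
  The truncation at 0 only increases a queue, so a queue of length \<open>o(t)\<close> certifies that the
  constraint holds on time average.
\<close>

lemma vqueue_ge_sum: "(\<Sum>k<t. a i \<bullet> x k - b i) \<le> vqueue a b x t $ i"
  by (induction t) (auto simp: max_def)

lemma vqueue_le:
  assumes "\<And>k. k < t \<Longrightarrow> a i \<bullet> x k - b i \<le> c" "0 \<le> c"
  shows "vqueue a b x t $ i \<le> real t * c"
  using assms(1)
proof (induction t)
  case (Suc t)
  then have "vqueue a b x t $ i \<le> real t * c" "a i \<bullet> x t - b i \<le> c" by auto
  then show ?case using assms(2) by (simp add: algebra_simps)
qed simp

lemma norm_vec_sq_eq_sum: "(norm q)\<^sup>2 = (\<Sum>i\<in>UNIV. (q $ i)\<^sup>2)" for q :: "real ^ 'k::finite"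
  unfolding power2_norm_eq_inner inner_vec_def by (simp add: power2_eq_square)

text \<open>
  This is \<open>(max c 0)^2 \<le> c^2\<close>, applied to every queue, with the square of
  \<open>c = q + (\<langle>a, x\<rangle> - b)\<close> multiplied out.
\<close>

lemma vqueue_drift:
  fixes x :: "nat \<Rightarrow> 'v::real_inner"
  shows "(norm (vqueue a b x (Suc t)))\<^sup>2 / 2 \<le> (norm (vqueue a b x t))\<^sup>2 / 2
     + (\<Sum>i\<in>UNIV. vqueue a b x t $ i * (a i \<bullet> x t - b i)) + (\<Sum>i\<in>UNIV. \<bar>a i \<bullet> x t - b i\<bar>\<^sup>2) / 2"
proof -
  have "(max (q + d) 0)\<^sup>2 \<le> q\<^sup>2 + 2 * (q * d) + \<bar>d\<bar>\<^sup>2" for q d :: real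
  proof -
    have "(max (q + d) 0)\<^sup>2 \<le> (q + d)\<^sup>2" by (auto simp: max_def)
    then show ?thesis by (simp add: power2_sum)
  qed
  from this[of "vqueue a b x t $ _" "a _ \<bullet> x t - b _"]
  have "(\<Sum>i\<in>UNIV. (vqueue a b x (Suc t) $ i)\<^sup>2) \<le> (\<Sum>i\<in>UNIV. (vqueue a b x t $ i)\<^sup>2
      + 2 * (vqueue a b x t $ i * (a i \<bullet> x t - b i)) + \<bar>a i \<bullet> x t - b i\<bar>\<^sup>2)"
    by (intro sum_mono) (simp add: add_diff_eq)
  then show ?thesis
    unfolding norm_vec_sq_eq_sum sum.distrib sum_distrib_left[symmetric] by simp
qed

text \<open>
  The decision minimizes a linear function of \<open>y\<close>; this is the vector representing it. It depends
  on the past only, which is what makes it independent of the current state.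
\<close>

definition decision_weight ::
  "real \<Rightarrow> ('v \<Rightarrow> 'v) \<Rightarrow> ('n::finite \<Rightarrow> 'v) \<Rightarrow> 'v \<Rightarrow> real ^ 'n \<Rightarrow> 'v::real_inner" where
  "decision_weight V g a \<gamma> q = V *\<^sub>R g \<gamma> + (\<Sum>i\<in>UNIV. (q $ i) *\<^sub>R a i)"

lemma decision_weight_inner:
  "decision_weight V g a \<gamma> q \<bullet> y = V * (g \<gamma> \<bullet> y) + (\<Sum>i\<in>UNIV. q $ i * (a i \<bullet> y))"
  by (simp add: decision_weight_def inner_add_left inner_sum_left)

section \<open>The drift-plus-penalty bound along one sample path\<close>

locale smooth_convex_problem =
  fixes BB :: "'v::euclidean_space set" and f :: "'v \<Rightarrow> real" and g :: "'v \<Rightarrow> 'v"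
    and a :: "'n::finite \<Rightarrow> 'v" and b :: "'n \<Rightarrow> real" and L M K B D :: real
  assumes compact: "compact BB" and zero: "0 \<in> BB"
    and deriv: "\<And>y. y \<in> BB \<Longrightarrow> (f has_derivative (\<lambda>h. g y \<bullet> h)) (at y within BB)"
    and lipschitz: "L-lipschitz_on BB g"
    and grad_le: "\<And>y. y \<in> BB \<Longrightarrow> norm (g y) \<le> M"
    and f_le: "\<And>y. y \<in> BB \<Longrightarrow> \<bar>f y\<bar> \<le> K"
    and slack_le: "\<And>y. y \<in> BB \<Longrightarrow> (\<Sum>i\<in>UNIV. \<bar>a i \<bullet> y - b i\<bar>\<^sup>2) \<le> B\<^sup>2"
    and diameter: "\<And>y z. y \<in> BB \<Longrightarrow> z \<in> BB \<Longrightarrow> norm (y - z) \<le> D"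
    and convex_f: "convex_on BB f"
begin

lemma convex: "convex BB"
  using convex_f by (rule convex_on_imp_convex)

lemma constants_nonneg: "0 \<le> L" "0 \<le> M" "0 \<le> K" "0 \<le> D"
  using lipschitz_on_nonneg[OF lipschitz] order.trans[OF norm_ge_zero grad_le[OF zero]]
    f_le[OF zero] diameter[OF zero zero] by auto

lemma norm_le_diameter: "y \<in> BB \<Longrightarrow> norm y \<le> D"
  using diameter[OF _ zero] by simp

lemma slack_le_abs: "y \<in> BB \<Longrightarrow> \<bar>a i \<bullet> y - b i\<bar> \<le> \<bar>B\<bar>"
proof -
  assume y: "y \<in> BB"
  have "\<bar>a i \<bullet> y - b i\<bar>\<^sup>2 \<le> (\<Sum>i\<in>UNIV. \<bar>a i \<bullet> y - b i\<bar>\<^sup>2)"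
    by (rule member_le_sum) auto
  also have "\<dots> \<le> B\<^sup>2" by (rule slack_le[OF y])
  finally show ?thesis by (simp add: abs_le_square_iff)
qed

text \<open>
  Smoothness bounds the change of \<open>f\<close> by \<open>\<eta> \<langle>g \<gamma>, x - \<gamma>\<rangle>\<close> plus a second order term, and the queue
  drift contributes \<open>\<Sum> q (\<langle>a, x\<rangle> - b)\<close>. After comparison with a feasible point \<open>y\<close>, the terms
  containing the decision combine to the weight applied to \<open>x - y\<close>, while convexity turns
  \<open>\<langle>g \<gamma>, y - \<gamma>\<rangle>\<close> into \<open>f y - f \<gamma>\<close>. Dividing the objective by \<open>\<eta>\<close> is what puts the two linear terms
  on the scale \<open>V\<close> of the weight.
\<close>

lemma drift_plus_penalty_step:
  assumes x: "\<And>k. x k \<in> BB" and \<eta>: "0 < \<eta>" "\<eta> \<le> 1" and V: "0 \<le> V"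
    and y: "y \<in> BB" "\<And>i. a i \<bullet> y \<le> b i"
  defines "\<gamma> \<equiv> gamma_prev \<eta> x" and "q \<equiv> vqueue a b x"
  shows "V / \<eta> * (f (\<gamma> (Suc t)) - f (\<gamma> t)) + ((norm (q (Suc t)))\<^sup>2 / 2 - (norm (q t))\<^sup>2 / 2)
           + V * (f (\<gamma> t) - f y)
         \<le> V * \<eta> * L * D\<^sup>2 / 2 + B\<^sup>2 / 2 + decision_weight V g a (\<gamma> t) (q t) \<bullet> (x t - y)"
proof -
  have \<gamma>: "\<gamma> k \<in> BB" for k
    unfolding \<gamma>_def using convex zero \<eta> x by (intro gamma_prev_mem) auto
  have step: "\<gamma> (Suc t) - \<gamma> t = \<eta> *\<^sub>R (x t - \<gamma> t)"
    by (simp add: \<gamma>_def algebra_simps)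
  have "f (\<gamma> (Suc t)) - f (\<gamma> t)
      \<le> \<eta> * (g (\<gamma> t) \<bullet> (x t - \<gamma> t)) + L / 2 * (\<eta> * norm (x t - \<gamma> t))\<^sup>2"
    using smooth_upper_bound[OF convex \<gamma> \<gamma> deriv lipschitz, of "Suc t" t] \<eta>
    unfolding step by simp
  also have "\<dots> \<le> \<eta> * (g (\<gamma> t) \<bullet> (x t - \<gamma> t)) + L / 2 * (\<eta> * D)\<^sup>2"
    using \<eta> constants_nonneg diameter[OF x \<gamma>]
    by (intro add_left_mono mult_left_mono power_mono) auto
  finally have "V / \<eta> * (f (\<gamma> (Suc t)) - f (\<gamma> t))
      \<le> V / \<eta> * (\<eta> * (g (\<gamma> t) \<bullet> (x t - \<gamma> t)) + L / 2 * (\<eta> * D)\<^sup>2)"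
    using V \<eta> by (intro mult_left_mono) auto
  also have "\<dots> = V * (g (\<gamma> t) \<bullet> (x t - \<gamma> t)) + V * \<eta> * L * D\<^sup>2 / 2"
    using \<eta> by (simp add: field_simps power2_eq_square)
  finally have 1: "V / \<eta> * (f (\<gamma> (Suc t)) - f (\<gamma> t))
      \<le> V * (g (\<gamma> t) \<bullet> (x t - \<gamma> t)) + V * \<eta> * L * D\<^sup>2 / 2" .
  have "(\<Sum>i\<in>UNIV. q t $ i * (a i \<bullet> x t - b i)) \<le> (\<Sum>i\<in>UNIV. q t $ i * (a i \<bullet> (x t - y)))"
    using y(2) by (intro sum_mono mult_left_mono) (auto simp: q_def vqueue_nonneg inner_diff_right)
  then have 2: "(norm (q (Suc t)))\<^sup>2 / 2 - (norm (q t))\<^sup>2 / 2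
      \<le> (\<Sum>i\<in>UNIV. q t $ i * (a i \<bullet> (x t - y))) + B\<^sup>2 / 2"
    using vqueue_drift[of a b x t] slack_le[OF x[of t]] unfolding q_def by linarith
  have "V * (f (\<gamma> t) - f y) \<le> V * (g (\<gamma> t) \<bullet> (\<gamma> t - y))"
    using convex_above_tangent[OF convex_f \<gamma>[of t] y(1) deriv] V
    by (intro mult_left_mono) (auto simp: inner_diff_right)
  moreover have "decision_weight V g a (\<gamma> t) (q t) \<bullet> (x t - y)
      = V * (g (\<gamma> t) \<bullet> (x t - \<gamma> t)) + V * (g (\<gamma> t) \<bullet> (\<gamma> t - y))
        + (\<Sum>i\<in>UNIV. q t $ i * (a i \<bullet> (x t - y)))"
    by (simp only: decision_weight_inner) (simp add: inner_diff_right right_diff_distrib)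
  ultimately show ?thesis using 1 2 by linarith
qed

lemma drift_plus_penalty_sum:
  assumes x: "\<And>k. x k \<in> BB" and \<eta>: "0 < \<eta>" "\<eta> \<le> 1" and V: "0 \<le> V"
    and y: "y \<in> BB" "\<And>i. a i \<bullet> y \<le> b i"
  defines "\<gamma> \<equiv> gamma_prev \<eta> x" and "q \<equiv> vqueue a b x"
  shows "(norm (q T))\<^sup>2 / 2 + V * (\<Sum>t<T. f (\<gamma> t) - f y)
         \<le> 2 * K * V / \<eta> + T * (V * \<eta> * L * D\<^sup>2 / 2 + B\<^sup>2 / 2)
            + (\<Sum>t<T. decision_weight V g a (\<gamma> t) (q t) \<bullet> (x t - y))"
proof -
  have "(\<Sum>t<T. V / \<eta> * (f (\<gamma> (Suc t)) - f (\<gamma> t)) + ((norm (q (Suc t)))\<^sup>2 / 2 - (norm (q t))\<^sup>2 / 2)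
           + V * (f (\<gamma> t) - f y))
     \<le> (\<Sum>t<T. V * \<eta> * L * D\<^sup>2 / 2 + B\<^sup>2 / 2 + decision_weight V g a (\<gamma> t) (q t) \<bullet> (x t - y))"
    unfolding \<gamma>_def q_def by (intro sum_mono drift_plus_penalty_step assms)
  also have "\<dots> = T * (V * \<eta> * L * D\<^sup>2 / 2 + B\<^sup>2 / 2)
            + (\<Sum>t<T. decision_weight V g a (\<gamma> t) (q t) \<bullet> (x t - y))"
    by (simp only: sum.distrib sum_constant card_lessThan) (simp add: distrib_left)
  finally have "V / \<eta> * (f (\<gamma> T) - f (\<gamma> 0)) + ((norm (q T))\<^sup>2 / 2 - (norm (q 0))\<^sup>2 / 2)
      + V * (\<Sum>t<T. f (\<gamma> t) - f y)
     \<le> T * (V * \<eta> * L * D\<^sup>2 / 2 + B\<^sup>2 / 2)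
            + (\<Sum>t<T. decision_weight V g a (\<gamma> t) (q t) \<bullet> (x t - y))"
    by (simp only: sum.distrib sum_distrib_left[symmetric]
        sum_lessThan_telescope[of "\<lambda>t. f (\<gamma> t)"]
        sum_lessThan_telescope[of "\<lambda>t. (norm (q t))\<^sup>2 / 2"])
  moreover have "(norm (q 0))\<^sup>2 = 0" by (simp add: q_def)
  moreover have "V / \<eta> * (f (\<gamma> 0) - f (\<gamma> T)) \<le> V / \<eta> * (2 * K)"
  proof (intro mult_left_mono)
    have "\<gamma> 0 \<in> BB" "\<gamma> T \<in> BB"
      unfolding \<gamma>_def using convex zero \<eta> x by (intro gamma_prev_mem; simp)+
    then show "f (\<gamma> 0) - f (\<gamma> T) \<le> 2 * K" using f_le[of "\<gamma> 0"] f_le[of "\<gamma> T"] by linarith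
  qed (use V \<eta> in auto)
  ultimately show ?thesis by (simp only: right_diff_distrib) (simp add: mult.commute)
qed

text \<open>
  Jensen's inequality for the average of the \<open>\<gamma>\<close>, corrected by the gradient bound times the
  distance \<open>|\<gamma>_T| / (\<eta> T) \<le> D / (\<eta> T)\<close> between the two time averages.
\<close>

lemma objective_of_average_le:
  assumes x: "\<And>k. x k \<in> BB" and \<eta>: "0 < \<eta>" "\<eta> \<le> 1" and T: "0 < T"
  shows "f ((1 / real T) *\<^sub>R (\<Sum>t<T. x t)) * T \<le> (\<Sum>t<T. f (gamma_prev \<eta> x t)) + M * D / \<eta>"
proof -
  define xb where "xb = (1 / real T) *\<^sub>R (\<Sum>t<T. x t)"
  define \<gamma>b where "\<gamma>b = (1 / real T) *\<^sub>R (\<Sum>t<T. gamma_prev \<eta> x t)"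
  have \<gamma>: "gamma_prev \<eta> x k \<in> BB" for k
    using convex zero \<eta> x by (intro gamma_prev_mem) auto
  have xb: "xb \<in> BB" and \<gamma>b: "\<gamma>b \<in> BB"
    unfolding xb_def \<gamma>b_def scaleR_sum_right using T x \<gamma> convex
    by (intro convex_sum; simp)+
  have "f \<gamma>b \<le> (\<Sum>t<T. (1 / real T) * f (gamma_prev \<eta> x t))"
    unfolding \<gamma>b_def scaleR_sum_right using T \<gamma>
    by (intro convex_on_sum[OF _ _ convex_f]) auto
  then have 1: "f \<gamma>b * T \<le> (\<Sum>t<T. f (gamma_prev \<eta> x t))"
    using T by (simp add: sum_divide_distrib[symmetric] field_simps)
  have "f xb - f \<gamma>b \<le> g xb \<bullet> (xb - \<gamma>b)"
    using convex_above_tangent[OF convex_f xb \<gamma>b deriv] by (simp add: inner_diff_right)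
  also have "\<dots> \<le> norm (g xb) * norm (xb - \<gamma>b)" by (rule norm_cauchy_schwarz)
  also have "\<dots> \<le> M * (D / (\<eta> * T))"
  proof (intro mult_mono grad_le xb)
    have "(\<Sum>t<T. x t) - (\<Sum>t<T. gamma_prev \<eta> x t) = (1 / \<eta>) *\<^sub>R gamma_prev \<eta> x T"
      using \<eta> by (simp flip: sum_gamma_prev[of \<eta> x T])
    then have "xb - \<gamma>b = (1 / (\<eta> * T)) *\<^sub>R gamma_prev \<eta> x T"
      by (simp add: xb_def \<gamma>b_def flip: scaleR_diff_right)
    then show "norm (xb - \<gamma>b) \<le> D / (\<eta> * T)"
      using norm_le_diameter[OF \<gamma>[of T]] \<eta> T by (simp add: divide_right_mono)
  qed (use constants_nonneg in auto)
  finally have "(f xb - f \<gamma>b) * T \<le> M * D / \<eta>"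
    using T \<eta> by (simp add: field_simps)
  then show ?thesis using 1 by (simp add: xb_def algebra_simps)
qed

end

section \<open>Expectations, kernels and independence\<close>

context prob_space
begin

lemma integrable_of_AE_bounded:
  fixes X :: "'a \<Rightarrow> 'v::euclidean_space"
  assumes "X \<in> borel_measurable M" "AE \<omega> in M. X \<omega> \<in> A" "bounded A"
  shows "integrable M X"
proof -
  obtain c where "\<And>y. y \<in> A \<Longrightarrow> norm y \<le> c" using assms(3) by (auto simp: bounded_iff)
  then have "AE \<omega> in M. norm (X \<omega>) \<le> c" using assms(2) by auto
  then show ?thesis using assms(1) by (rule integrable_const_bound)
qed

lemma expectation_inner_ge:
  fixes X :: "'a \<Rightarrow> 'v::euclidean_space"
  assumes "integrable M X" "AE \<omega> in M. c \<le> v \<bullet> X \<omega>"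
  shows "c \<le> v \<bullet> (\<integral>\<omega>. X \<omega> \<partial>M)"
proof -
  have "(\<integral>\<omega>. c \<partial>M) \<le> (\<integral>\<omega>. v \<bullet> X \<omega> \<partial>M)"
    using assms by (intro integral_mono_AE) auto
  then show ?thesis using assms(1) by (simp add: prob_space)
qed

text \<open>
  A hyperplane strictly separating the mean from the set would also separate the mean from
  itself.
\<close>

lemma expectation_mem_closed_convex:
  fixes X :: "'a \<Rightarrow> 'v::euclidean_space"
  assumes "closed A" "convex A" "integrable M X" "AE \<omega> in M. X \<omega> \<in> A"
  shows "(\<integral>\<omega>. X \<omega> \<partial>M) \<in> A"
proof (rule ccontr)
  assume "\<not> ?thesis"
  then obtain v c where v: "v \<bullet> (\<integral>\<omega>. X \<omega> \<partial>M) < c" "\<And>y. y \<in> A \<Longrightarrow> c < v \<bullet> y"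
    using separating_hyperplane_closed_point[OF assms(2,1)] by blast
  have "AE \<omega> in M. c \<le> v \<bullet> X \<omega>"
    using assms(4) by eventually_elim (use v(2) in \<open>auto intro: less_imp_le\<close>)
  from expectation_inner_ge[OF assms(3) this] v(1) show False by simp
qed

text \<open>
  The identity function is unbounded, but it agrees almost everywhere with its truncation to
  \<open>A\<close>; applied to each coordinate, this reduces the claim to bounded real functions.
\<close>

lemma integral_bind_of_bounded_support:
  fixes A :: "'v::euclidean_space set"
  assumes N: "N \<in> M \<rightarrow>\<^sub>M prob_algebra borel" and A: "closed A" "bounded A"
    and supp: "\<And>\<omega>. \<omega> \<in> space M \<Longrightarrow> AE y in N \<omega>. y \<in> A"
  shows "(\<integral>y. y \<partial>(M \<bind> N)) = (\<integral>\<omega>. (\<integral>y. y \<partial>N \<omega>) \<partial>M)"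
proof -
  have N': "N \<in> M \<rightarrow>\<^sub>M subprob_algebra borel" using N by (rule measurable_prob_algebraD)
  have prob_N: "prob_space (N \<omega>)" and sets_N [measurable_cong]: "sets (N \<omega>) = sets borel"
    if "\<omega> \<in> space M" for \<omega>
    using measurable_space[OF N that] by (auto simp: space_prob_algebra)
  have M: "M \<in> space (prob_algebra M)" by (simp add: space_prob_algebra prob_space_axioms)
  interpret bind: prob_space "M \<bind> N" using M N by (rule prob_space_bind')
  have [measurable_cong]: "sets (M \<bind> N) = sets borel" using M N by (rule sets_bind')
  have [measurable]: "A \<in> sets borel" using A by simp
  have supp_bind: "AE y in M \<bind> N. y \<in> A"
    using supp by (subst AE_bind[OF N']) auto
  have int_bind: "integrable (M \<bind> N) (\<lambda>y. y)"
    using supp_bind A by (intro bind.integrable_of_AE_bounded) auto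
  have int_N: "integrable (N \<omega>) (\<lambda>y. y)" if "\<omega> \<in> space M" for \<omega>
    using that A(2)
    by (intro prob_space.integrable_of_AE_bounded[OF prob_N _ supp] measurable_ident_sets[OF sets_N])
  have meas: "(\<lambda>\<omega>. \<integral>y. y \<partial>N \<omega>) \<in> borel_measurable M"
    using N' by (rule measurable_compose) measurable
  have mem: "(\<integral>y. y \<partial>N \<omega>) \<in> closure (convex hull A)" if "\<omega> \<in> space M" for \<omega>
    using supp[OF that] hull_subset[of A convex] closure_subset[of "convex hull A"]
    by (intro prob_space.expectation_mem_closed_convex[OF prob_N[OF that]] int_N that) auto
  have int_mean: "integrable M (\<lambda>\<omega>. \<integral>y. y \<partial>N \<omega>)"
    using meas mem A
    by (intro integrable_of_AE_bounded[where A = "closure (convex hull A)"] AE_I2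
        bounded_closure bounded_convex_hull) auto
  show ?thesis
  proof (rule euclidean_eqI)
    fix e :: 'v assume "e \<in> Basis"
    obtain c where c: "\<And>y. y \<in> A \<Longrightarrow> norm y \<le> c" "0 \<le> c"
      using A(2) by (meson bounded_pos less_imp_le)
    define h where "h y = (y \<bullet> e) * indicator A y" for y :: 'v
    have [measurable]: "h \<in> borel_measurable borel" unfolding h_def by measurable
    have h_bound: "\<bar>h y\<bar> \<le> c" for y
      using c Basis_le_norm[OF \<open>e \<in> Basis\<close>, of y] by (auto simp: h_def indicator_def intro: order.trans)
    have "(\<integral>y. y \<partial>(M \<bind> N)) \<bullet> e = (\<integral>y. y \<bullet> e \<partial>(M \<bind> N))"
      using int_bind by simp
    also have "\<dots> = (\<integral>y. h y \<partial>(M \<bind> N))"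
      using supp_bind by (intro integral_cong_AE) (auto simp: h_def)
    also have "\<dots> = (\<integral>\<omega>. (\<integral>y. h y \<partial>N \<omega>) \<partial>M)"
      using h_bound N' finite_measure_axioms prob_N
      by (intro integral_bind[where B = c and B' = 1]) (auto simp: prob_space.emeasure_space_1)
    also have "\<dots> = (\<integral>\<omega>. (\<integral>y. y \<partial>N \<omega>) \<bullet> e \<partial>M)"
    proof (rule Bochner_Integration.integral_cong[OF refl])
      fix \<omega> assume \<omega>: "\<omega> \<in> space M"
      note [measurable_cong] = sets_N[OF \<omega>]
      have "(\<integral>y. h y \<partial>N \<omega>) = (\<integral>y. y \<bullet> e \<partial>N \<omega>)"
        using supp[OF \<omega>] by (intro integral_cong_AE) (auto simp: h_def)
      then show "(\<integral>y. h y \<partial>N \<omega>) = (\<integral>y. y \<partial>N \<omega>) \<bullet> e" using int_N[OF \<omega>] by simp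
    qed
    also have "\<dots> = (\<integral>\<omega>. (\<integral>y. y \<partial>N \<omega>) \<partial>M) \<bullet> e" using int_mean by simp
    finally show "(\<integral>y. y \<partial>(M \<bind> N)) \<bullet> e = (\<integral>\<omega>. (\<integral>y. y \<partial>N \<omega>) \<partial>M) \<bullet> e" .
  qed
qed

text \<open>
  Independence as factorization of the joint law. In contrast to \<open>indep_var\<close>, the two variables
  may have different types: here one is a history and the other is a state.
\<close>

definition indep_pair :: "'b measure \<Rightarrow> ('a \<Rightarrow> 'b) \<Rightarrow> 'c measure \<Rightarrow> ('a \<Rightarrow> 'c) \<Rightarrow> bool" where
  "indep_pair N X R Y \<longleftrightarrow> random_variable N X \<and> random_variable R Y \<and>
     distr M N X \<Otimes>\<^sub>M distr M R Y = distr M (N \<Otimes>\<^sub>M R) (\<lambda>\<omega>. (X \<omega>, Y \<omega>))"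

lemma indep_var_iff_indep_pair: "indep_var N X R Y \<longleftrightarrow> indep_pair N X R Y"
  by (simp add: indep_pair_def indep_var_distribution_eq)

lemma indep_pair_compose:
  assumes indep: "indep_pair N X R Y"
    and f [measurable]: "f \<in> N \<rightarrow>\<^sub>M N'" and g [measurable]: "g \<in> R \<rightarrow>\<^sub>M R'"
  shows "indep_pair N' (\<lambda>\<omega>. f (X \<omega>)) R' (\<lambda>\<omega>. g (Y \<omega>))"
proof -
  have [measurable]: "X \<in> M \<rightarrow>\<^sub>M N" "Y \<in> M \<rightarrow>\<^sub>M R"
    and joint: "distr M N X \<Otimes>\<^sub>M distr M R Y = distr M (N \<Otimes>\<^sub>M R) (\<lambda>\<omega>. (X \<omega>, Y \<omega>))"
    using indep by (auto simp: indep_pair_def)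
  interpret Y: prob_space "distr (distr M R Y) R' g"
    by (intro prob_space.prob_space_distr prob_space_distr) auto
  have "distr M N' (\<lambda>\<omega>. f (X \<omega>)) \<Otimes>\<^sub>M distr M R' (\<lambda>\<omega>. g (Y \<omega>))
      = distr (distr M N X) N' f \<Otimes>\<^sub>M distr (distr M R Y) R' g"
    by (simp add: distr_distr o_def)
  also have "\<dots> = distr (distr M N X \<Otimes>\<^sub>M distr M R Y) (N' \<Otimes>\<^sub>M R') (\<lambda>(x, y). (f x, g y))"
    by (rule pair_measure_distr) (auto intro: Y.sigma_finite_measure_axioms)
  also have "\<dots> = distr M (N' \<Otimes>\<^sub>M R') (\<lambda>\<omega>. (f (X \<omega>), g (Y \<omega>)))"
    unfolding joint by (subst distr_distr) (auto simp: o_def)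
  finally show ?thesis by (simp add: indep_pair_def)
qed

lemma indep_pair_cong:
  assumes "indep_pair N X R Y" "\<And>\<omega>. \<omega> \<in> space M \<Longrightarrow> X \<omega> = X' \<omega>" "\<And>\<omega>. \<omega> \<in> space M \<Longrightarrow> Y \<omega> = Y' \<omega>"
  shows "indep_pair N X' R Y'"
proof -
  have "distr M N X' = distr M N X" "distr M R Y' = distr M R Y"
    "distr M (N \<Otimes>\<^sub>M R) (\<lambda>\<omega>. (X' \<omega>, Y' \<omega>)) = distr M (N \<Otimes>\<^sub>M R) (\<lambda>\<omega>. (X \<omega>, Y \<omega>))"
    using assms(2,3) by (auto intro!: distr_cong)
  moreover have "X' \<in> M \<rightarrow>\<^sub>M N \<longleftrightarrow> X \<in> M \<rightarrow>\<^sub>M N" "Y' \<in> M \<rightarrow>\<^sub>M R \<longleftrightarrow> Y \<in> M \<rightarrow>\<^sub>M R"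
    using assms(2,3) by (auto intro!: measurable_cong)
  ultimately show ?thesis using assms(1) by (simp add: indep_pair_def)
qed

lemma expectation_inner_indep:
  fixes X Y :: "'a \<Rightarrow> 'v::euclidean_space"
  assumes indep: "indep_var borel X borel Y" and int: "integrable M X" "integrable M Y"
  shows "(\<integral>\<omega>. X \<omega> \<bullet> Y \<omega> \<partial>M) = (\<integral>\<omega>. X \<omega> \<partial>M) \<bullet> (\<integral>\<omega>. Y \<omega> \<partial>M)"
proof -
  have ind: "indep_var borel (\<lambda>\<omega>. X \<omega> \<bullet> e) borel (\<lambda>\<omega>. Y \<omega> \<bullet> e)" for e
    using indep_var_compose[OF indep, of "\<lambda>y. y \<bullet> e" borel "\<lambda>y. y \<bullet> e" borel] by (simp add: o_def)
  have "(\<integral>\<omega>. X \<omega> \<bullet> Y \<omega> \<partial>M) = (\<integral>\<omega>. (\<Sum>e\<in>Basis. (X \<omega> \<bullet> e) * (Y \<omega> \<bullet> e)) \<partial>M)"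
    by (subst euclidean_inner) (rule refl)
  also have "\<dots> = (\<Sum>e\<in>Basis. (\<integral>\<omega>. (X \<omega> \<bullet> e) * (Y \<omega> \<bullet> e) \<partial>M))"
    using int by (intro Bochner_Integration.integral_sum indep_var_integrable[OF ind]) auto
  also have "\<dots> = (\<Sum>e\<in>Basis. ((\<integral>\<omega>. X \<omega> \<partial>M) \<bullet> e) * ((\<integral>\<omega>. Y \<omega> \<partial>M) \<bullet> e))"
    using int by (intro sum.cong refl) (simp add: indep_var_lebesgue_integral[OF ind])
  also have "\<dots> = (\<integral>\<omega>. X \<omega> \<partial>M) \<bullet> (\<integral>\<omega>. Y \<omega> \<partial>M)"
    by (rule euclidean_inner[symmetric])
  finally show ?thesis .
qed

text \<open>
  Restricting the target space to a set containing all values adds no events, even if that set is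
  not measurable.
\<close>

lemma indep_vars_restrict_space:
  assumes "indep_vars (\<lambda>_. N) X I" "\<And>i \<omega>. i \<in> I \<Longrightarrow> \<omega> \<in> space M \<Longrightarrow> X i \<omega> \<in> A"
  shows "indep_vars (\<lambda>_. restrict_space N A) X I"
proof -
  have "{X i -` C \<inter> space M | C. C \<in> sets (restrict_space N A)}
      \<subseteq> {X i -` C \<inter> space M | C. C \<in> sets N}" if "i \<in> I" for i
  proof safe
    fix C assume "C \<in> sets (restrict_space N A)"
    then obtain C' where "C' \<in> sets N" "C = A \<inter> C'" by (auto simp: sets_restrict_space)
    then show "\<exists>C'. X i -` C \<inter> space M = X i -` C' \<inter> space M \<and> C' \<in> sets N"
      using assms(2)[OF that] by (intro exI[of _ C']) auto
  qed
  then show ?thesis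
    using assms unfolding indep_vars_def2
    by (auto intro!: measurable_restrict_space2 elim!: indep_sets_mono_sets)
qed

end

section \<open>Randomized stationary algorithms under i.i.d. states\<close>

locale iid_states = prob_space P for P :: "'w measure" +
  fixes S :: "nat \<Rightarrow> 'w \<Rightarrow> 's::topological_space" and SS :: "'s set"
    and X :: "'s \<Rightarrow> 'v::euclidean_space set" and BB :: "'v set"
  assumes compact_BB: "compact BB" and convex_BB: "convex BB"
    and indep_states: "indep_vars (\<lambda>_. borel) S UNIV"
    and identically_distributed: "\<And>t. distr P borel (S t) = distr P borel (S 0)"
    and state_mem: "\<And>t \<omega>. \<omega> \<in> space P \<Longrightarrow> S t \<omega> \<in> SS"
    and options: "\<And>s. s \<in> SS \<Longrightarrow> X s \<noteq> {} \<and> compact (X s) \<and> X s \<subseteq> BB"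
begin

abbreviation states :: "'s measure" where "states \<equiv> restrict_space borel SS"

lemma space_states [simp]: "space states = SS"
  by (simp add: space_restrict_space)

lemma indep_states': "indep_vars (\<lambda>_. states) S UNIV"
  using indep_states state_mem by (rule indep_vars_restrict_space)

lemma state_measurable [measurable]: "S t \<in> P \<rightarrow>\<^sub>M states"
  using indep_states' by (auto simp: indep_vars_def)

lemma distr_state: "distr P states (S t) = distr P states (S 0)"
proof (rule measure_eqI)
  fix A assume A: "A \<in> sets (distr P states (S t))"
  then obtain C where C: "C \<in> sets borel" "A = SS \<inter> C" by (auto simp: sets_restrict_space)
  have "emeasure (distr P states (S k)) A = emeasure (distr P borel (S k)) C" for k
  proof -
    have [measurable]: "S k \<in> P \<rightarrow>\<^sub>M borel" using indep_states by (auto simp: indep_vars_def)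
    have "S k -` A \<inter> space P = S k -` C \<inter> space P" using C state_mem by auto
    then show ?thesis using A C(1) by (simp add: emeasure_distr)
  qed
  then show "emeasure (distr P states (S t)) A = emeasure (distr P states (S 0)) A"
    by (simp add: identically_distributed[of t])
qed simp

lemma expectation_state:
  fixes h :: "'s \<Rightarrow> 'v"
  assumes [measurable]: "h \<in> borel_measurable states"
  shows "(\<integral>\<omega>. h (S t \<omega>) \<partial>P) = (\<integral>\<omega>. h (S t' \<omega>) \<partial>P)"
proof -
  have "(\<integral>\<omega>. h (S k \<omega>) \<partial>P) = (\<integral>s. h s \<partial>distr P states (S 0))" for k
    unfolding distr_state[of k, symmetric] by (rule integral_distr[symmetric]) measurable
  then show ?thesis by simp
qed

context
  fixes \<kappa> :: "'s \<Rightarrow> 'v measure"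
  assumes \<kappa>: "randomized_stationary SS X \<kappa>"
begin

lemma kernel_measurable: "\<kappa> \<in> states \<rightarrow>\<^sub>M prob_algebra borel"
  using \<kappa> by (simp add: randomized_stationary_def)

lemma kernel_prob_space: "s \<in> SS \<Longrightarrow> prob_space (\<kappa> s)"
  and kernel_sets: "s \<in> SS \<Longrightarrow> sets (\<kappa> s) = sets borel"
  using measurable_space[OF kernel_measurable, of s] by (auto simp: space_prob_algebra)

lemma kernel_AE: "s \<in> SS \<Longrightarrow> AE y in \<kappa> s. y \<in> X s"
  using \<kappa> by (auto simp: randomized_stationary_def)

lemma kernel_AE_BB: "s \<in> SS \<Longrightarrow> AE y in \<kappa> s. y \<in> BB"
  using kernel_AE[of s] options[of s] by auto

lemma kernel_integrable: "s \<in> SS \<Longrightarrow> integrable (\<kappa> s) (\<lambda>y. y)"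
  using compact_BB
  by (intro prob_space.integrable_of_AE_bounded[OF kernel_prob_space _ kernel_AE_BB]
      measurable_ident_sets[OF kernel_sets] compact_imp_bounded)

lemma kernel_mean_measurable: "(\<lambda>s. \<integral>y. y \<partial>\<kappa> s) \<in> borel_measurable states"
  using measurable_prob_algebraD[OF kernel_measurable] by (rule measurable_compose) measurable

lemma kernel_mean_mem: "s \<in> SS \<Longrightarrow> (\<integral>y. y \<partial>\<kappa> s) \<in> BB"
  using compact_BB convex_BB
  by (intro prob_space.expectation_mem_closed_convex[OF kernel_prob_space] kernel_integrable
      kernel_AE_BB compact_imp_closed)

lemma kernel_mean_integrable: "integrable P (\<lambda>\<omega>. \<integral>y. y \<partial>\<kappa> (S t \<omega>))"
  using kernel_mean_mem state_mem compact_BB measurable_compose[OF state_measurable kernel_mean_measurable]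
  by (intro integrable_of_AE_bounded[where A = BB] AE_I2) (auto intro: compact_imp_bounded)

text \<open>
  A kernel enters only through its conditional mean given the state, and since the states are
  identically distributed, the slot does not matter.
\<close>

lemma mean_under_kernel:
  "(\<integral>y. y \<partial>(P \<bind> (\<lambda>\<omega>. \<kappa> (S t \<omega>)))) = (\<integral>\<omega>. (\<integral>y. y \<partial>\<kappa> (S t' \<omega>)) \<partial>P)"
proof -
  have "(\<integral>y. y \<partial>(P \<bind> (\<lambda>\<omega>. \<kappa> (S t \<omega>)))) = (\<integral>\<omega>. (\<integral>y. y \<partial>\<kappa> (S t \<omega>)) \<partial>P)"
    using compact_BB kernel_AE_BB state_mem
    by (intro integral_bind_of_bounded_support[where A = BB]
        measurable_compose[OF state_measurable kernel_measurable])
       (auto intro: compact_imp_closed compact_imp_bounded)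
  then show ?thesis
    using expectation_state[OF kernel_mean_measurable, of t t'] by simp
qed

end

lemma achievable_means_eq:
  "achievable_means P S SS X =
     {\<integral>\<omega>. (\<integral>y. y \<partial>\<kappa> (S t \<omega>)) \<partial>P | \<kappa>. randomized_stationary SS X \<kappa>}"
  (is "?A = ?B")
proof
  show "?A \<subseteq> ?B"
  proof
    fix y assume "y \<in> ?A"
    then obtain \<kappa> t' where \<kappa>: "randomized_stationary SS X \<kappa>"
      and y: "y = (\<integral>y. y \<partial>(P \<bind> (\<lambda>\<omega>. \<kappa> (S t' \<omega>))))"
      by (auto simp: achievable_means_def)
    from \<kappa> show "y \<in> ?B" unfolding y mean_under_kernel[OF \<kappa>, of t' t] by blast
  qed
  show "?B \<subseteq> ?A"
  proof
    fix y assume "y \<in> ?B"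
    then obtain \<kappa> where \<kappa>: "randomized_stationary SS X \<kappa>"
      and y: "y = (\<integral>\<omega>. (\<integral>y. y \<partial>\<kappa> (S t \<omega>)) \<partial>P)"
      by auto
    from \<kappa> show "y \<in> ?A"
      unfolding y mean_under_kernel[OF \<kappa>, of t t, symmetric] achievable_means_def by blast
  qed
qed

lemma achievable_means_subset: "achievable_means P S SS X \<subseteq> BB"
proof
  fix y assume "y \<in> achievable_means P S SS X"
  then obtain \<kappa> where \<kappa>: "randomized_stationary SS X \<kappa>"
    and y: "y = (\<integral>\<omega>. (\<integral>y. y \<partial>\<kappa> (S 0 \<omega>)) \<partial>P)"
    unfolding achievable_means_eq[of 0] by auto
  show "y \<in> BB"
    unfolding y using compact_BB convex_BB
    by (intro expectation_mem_closed_convex kernel_mean_integrable[OF \<kappa>] AE_I2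
        kernel_mean_mem[OF \<kappa>] state_mem compact_imp_closed)
qed

text \<open>
  To realize a convex combination, toss a coin with bias \<open>u\<close> and follow the one or the other
  kernel.
\<close>

lemma convex_achievable_means: "convex (achievable_means P S SS X)"
proof (rule convexI)
  fix y z and u v :: real
  assume "y \<in> achievable_means P S SS X" "z \<in> achievable_means P S SS X"
    and uv: "0 \<le> u" "0 \<le> v" "u + v = 1"
  then obtain \<kappa> \<mu> where \<kappa>: "randomized_stationary SS X \<kappa>" "y = (\<integral>\<omega>. (\<integral>y. y \<partial>\<kappa> (S 0 \<omega>)) \<partial>P)"
    and \<mu>: "randomized_stationary SS X \<mu>" "z = (\<integral>\<omega>. (\<integral>y. y \<partial>\<mu> (S 0 \<omega>)) \<partial>P)"
    unfolding achievable_means_eq[of 0] by auto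
  define coin where "coin = measure_pmf (bernoulli_pmf u)"
  define \<nu> where "\<nu> s = coin \<bind> (\<lambda>c. if c then \<kappa> s else \<mu> s)" for s
  interpret coin: prob_space coin unfolding coin_def by (rule measure_pmf.prob_space_axioms)
  have sets_coin [measurable_cong]: "sets coin = sets (count_space UNIV)" by (simp add: coin_def)
  note km = kernel_measurable[OF \<kappa>(1)] kernel_measurable[OF \<mu>(1)]
  have branch: "(\<lambda>c. if c then \<kappa> s else \<mu> s) \<in> coin \<rightarrow>\<^sub>M prob_algebra borel" if "s \<in> SS" for s
    using that km[THEN measurable_space, of s] by (auto simp: measurable_def coin_def)
  have "\<nu> \<in> states \<rightarrow>\<^sub>M prob_algebra borel"
    unfolding \<nu>_def
  proof (rule measurable_bind_prob_space2)
    show "(\<lambda>s. coin) \<in> states \<rightarrow>\<^sub>M prob_algebra coin"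
      by (simp add: space_prob_algebra coin.prob_space_axioms)
    have [measurable]: "Measurable.pred (states \<Otimes>\<^sub>M coin) snd"
      using measurable_snd[of states coin] unfolding measurable_cong_sets[OF refl sets_coin] .
    have "(\<lambda>p. if snd p then \<kappa> (fst p) else \<mu> (fst p)) \<in> states \<Otimes>\<^sub>M coin \<rightarrow>\<^sub>M prob_algebra borel"
      using km by (intro measurable_If measurable_compose[OF measurable_fst]) (auto simp: pred_def)
    then show "(\<lambda>(s, c). if c then \<kappa> s else \<mu> s) \<in> states \<Otimes>\<^sub>M coin \<rightarrow>\<^sub>M prob_algebra borel"
      by (simp add: case_prod_beta)
  qed
  moreover have "AE y in \<nu> s. y \<in> X s" if "s \<in> SS" for s
  proof -
    have "X s \<in> sets borel" using options[OF that] by (auto intro: borel_compact)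
    then have "Measurable.pred borel (\<lambda>y. y \<in> X s)" by simp
    moreover have "AE y in (if c then \<kappa> s else \<mu> s). y \<in> X s" for c
      using kernel_AE[OF \<kappa>(1) that] kernel_AE[OF \<mu>(1) that] by simp
    ultimately show ?thesis
      unfolding \<nu>_def by (simp add: AE_bind[OF measurable_prob_algebraD[OF branch[OF that]]])
  qed
  ultimately have \<nu>: "randomized_stationary SS X \<nu>"
    by (simp add: randomized_stationary_def)
  have "(\<integral>y. y \<partial>\<nu> s) = u *\<^sub>R (\<integral>y. y \<partial>\<kappa> s) + v *\<^sub>R (\<integral>y. y \<partial>\<mu> s)" if "s \<in> SS" for s
  proof -
    have "(\<integral>y. y \<partial>\<nu> s) = (\<integral>c. (\<integral>y. y \<partial>(if c then \<kappa> s else \<mu> s)) \<partial>coin)"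
      using kernel_AE_BB[OF \<kappa>(1) that] kernel_AE_BB[OF \<mu>(1) that] compact_BB
      unfolding \<nu>_def by (intro coin.integral_bind_of_bounded_support[where A = BB] branch that)
        (auto intro: compact_imp_closed compact_imp_bounded)
    moreover have "v = 1 - u" "u \<le> 1" using uv by simp_all
    ultimately show ?thesis
      using uv(1) by (subst (asm) coin_def, subst (asm) integral_measure_pmf[of UNIV])
        (auto simp: UNIV_bool)
  qed
  then have "(\<integral>\<omega>. (\<integral>y. y \<partial>\<nu> (S 0 \<omega>)) \<partial>P)
      = (\<integral>\<omega>. u *\<^sub>R (\<integral>y. y \<partial>\<kappa> (S 0 \<omega>)) + v *\<^sub>R (\<integral>y. y \<partial>\<mu> (S 0 \<omega>)) \<partial>P)"
    by (intro Bochner_Integration.integral_cong refl) (simp add: state_mem)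
  also have "\<dots> = u *\<^sub>R y + v *\<^sub>R z"
    using kernel_mean_integrable[OF \<kappa>(1), of 0] kernel_mean_integrable[OF \<mu>(1), of 0]
    by (simp add: \<kappa>(2) \<mu>(2))
  finally show "u *\<^sub>R y + v *\<^sub>R z \<in> achievable_means P S SS X"
    using \<nu> unfolding achievable_means_eq[of 0] by (metis (mono_tags, lifting) mem_Collect_eq)
qed

text \<open>
  A controller that looks at some information \<open>H\<close> independent of the current state, such as the
  history, and applies a rule \<open>\<phi>\<close> to it and to the state.
\<close>

context
  fixes N :: "'h measure" and H :: "'w \<Rightarrow> 'h" and t :: nat and \<phi> :: "'h \<times> 's \<Rightarrow> 'v"
  assumes indep: "indep_pair N H states (S t)"
    and \<phi> [measurable]: "\<phi> \<in> borel_measurable (N \<Otimes>\<^sub>M states)"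
    and \<phi>_mem: "\<And>h s. h \<in> space N \<Longrightarrow> s \<in> SS \<Longrightarrow> \<phi> (h, s) \<in> X s"
begin

lemma history_measurable: "H \<in> P \<rightarrow>\<^sub>M N"
  using indep by (simp add: indep_pair_def)

lemma decision_mem: "\<omega> \<in> space P \<Longrightarrow> \<phi> (H \<omega>, S t \<omega>) \<in> BB"
  using \<phi>_mem[of "H \<omega>" "S t \<omega>"] state_mem[of \<omega> t] options measurable_space[OF history_measurable, of \<omega>]
  by blast

lemma decision_integrable: "integrable P (\<lambda>\<omega>. \<phi> (H \<omega>, S t \<omega>))"
  supply history_measurable [measurable]
  using decision_mem compact_BB
  by (intro integrable_of_AE_bounded[where A = BB] AE_I2) (auto intro: compact_imp_bounded)

text \<open>
  Relative to the current state, independent information is mere randomization: the kernel that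
  draws a fresh copy of \<open>H\<close> and applies \<open>\<phi>\<close> has the same mean, by Fubini.
\<close>

lemma expected_decision_achievable:
  "(\<integral>\<omega>. \<phi> (H \<omega>, S t \<omega>) \<partial>P) \<in> achievable_means P S SS X"
proof -
  note [measurable] = history_measurable
  define \<kappa> where "\<kappa> s = distr P borel (\<lambda>\<omega>. \<phi> (H \<omega>, s))" for s
  have [measurable]: "(\<lambda>\<omega>. \<phi> (H \<omega>, s)) \<in> borel_measurable P" if "s \<in> SS" for s
    using that by (intro measurable_compose[OF measurable_Pair \<phi>]) auto
  have "\<kappa> \<in> states \<rightarrow>\<^sub>M prob_algebra borel"
    unfolding \<kappa>_def
    by (rule measurable_distr_prob_space2[where M = P])
       (auto simp: space_prob_algebra prob_space_axioms)
  moreover have "AE y in \<kappa> s. y \<in> X s" if "s \<in> SS" for s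
    using that options[OF that] \<phi>_mem measurable_space[OF history_measurable]
    unfolding \<kappa>_def by (subst AE_distr_iff) (auto intro!: AE_I2 borel_compact)
  ultimately have \<kappa>: "randomized_stationary SS X \<kappa>"
    by (simp add: randomized_stationary_def)
  let ?H = "distr P N H" and ?S = "distr P states (S t)"
  have joint: "?H \<Otimes>\<^sub>M ?S = distr P (N \<Otimes>\<^sub>M states) (\<lambda>\<omega>. (H \<omega>, S t \<omega>))"
    using indep by (simp add: indep_pair_def)
  interpret H: prob_space ?H by (rule prob_space_distr) measurable
  interpret St: prob_space ?S by (rule prob_space_distr) measurable
  interpret HS: pair_prob_space ?H ?S ..
  have int: "integrable (?H \<Otimes>\<^sub>M ?S) \<phi>"
    unfolding joint by (subst integrable_distr_eq) (use decision_integrable in auto)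
  have "(\<integral>\<omega>. \<phi> (H \<omega>, S t \<omega>) \<partial>P) = (\<integral>p. \<phi> p \<partial>(?H \<Otimes>\<^sub>M ?S))"
    unfolding joint by (subst integral_distr) auto
  also have "\<dots> = (\<integral>s. (\<integral>h. \<phi> (h, s) \<partial>?H) \<partial>?S)"
    using HS.integral_snd[of "\<lambda>h s. \<phi> (h, s)"] int by simp
  also have "\<dots> = (\<integral>\<omega>. (\<integral>h. \<phi> (h, S t \<omega>) \<partial>?H) \<partial>P)"
    by (subst integral_distr) auto
  also have "\<dots> = (\<integral>\<omega>. (\<integral>y. y \<partial>\<kappa> (S t \<omega>)) \<partial>P)"
  proof (rule Bochner_Integration.integral_cong[OF refl])
    fix \<omega> assume \<omega>: "\<omega> \<in> space P"
    then have s: "S t \<omega> \<in> SS" by (rule state_mem)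
    have "(\<lambda>h. \<phi> (h, S t \<omega>)) \<in> borel_measurable N"
      using s by (intro measurable_compose[OF measurable_Pair \<phi>]) auto
    then show "(\<integral>h. \<phi> (h, S t \<omega>) \<partial>?H) = (\<integral>y. y \<partial>\<kappa> (S t \<omega>))"
      using s unfolding \<kappa>_def by (simp add: integral_distr)
  qed
  finally show ?thesis using \<kappa> unfolding achievable_means_eq[of t] by auto
qed

text \<open>
  The decision \<open>\<phi>\<close> beats every option pointwise, hence also the conditional mean \<open>m (S t)\<close> of every
  kernel. As \<open>c (H)\<close> and \<open>m (S t)\<close> are independent, \<open>c (H)\<close> is tested only against the mean of
  \<open>m (S t)\<close>, that is against an achievable point. The resulting inequality is linear in that point, so
  it passes to the closure.
\<close>

lemma expected_weighted_decision_le: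
  assumes c [measurable]: "c \<in> borel_measurable N"
    and bound: "\<And>\<omega>. \<omega> \<in> space P \<Longrightarrow> norm (c (H \<omega>)) \<le> C"
    and min: "\<And>h s y. h \<in> space N \<Longrightarrow> s \<in> SS \<Longrightarrow> y \<in> X s \<Longrightarrow> c h \<bullet> \<phi> (h, s) \<le> c h \<bullet> y"
    and z: "z \<in> closure (achievable_means P S SS X)"
  shows "(\<integral>\<omega>. c (H \<omega>) \<bullet> (\<phi> (H \<omega>, S t \<omega>) - z) \<partial>P) \<le> 0"
proof -
  note [measurable] = history_measurable
  have int_c: "integrable P (\<lambda>\<omega>. c (H \<omega>))"
    using bound by (intro integrable_const_bound[where B = C] AE_I2) auto
  have int_inner: "integrable P (\<lambda>\<omega>. c (H \<omega>) \<bullet> Y \<omega>)"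
    if [measurable]: "Y \<in> borel_measurable P" and Y: "\<And>\<omega>. \<omega> \<in> space P \<Longrightarrow> Y \<omega> \<in> BB" for Y
  proof -
    obtain r where r: "\<And>y. y \<in> BB \<Longrightarrow> norm y \<le> r"
      using compact_BB by (meson bounded_iff compact_imp_bounded)
    have "norm (c (H \<omega>) \<bullet> Y \<omega>) \<le> C * r" if "\<omega> \<in> space P" for \<omega>
      using bound[OF that] r[OF Y[OF that]] Cauchy_Schwarz_ineq2[of "c (H \<omega>)" "Y \<omega>"]
        mult_mono[OF bound[OF that] r[OF Y[OF that]]] norm_ge_zero[of "c (H \<omega>)"]
      by (auto intro: order.trans)
    then show ?thesis by (intro integrable_const_bound[where B = "C * r"] AE_I2) auto
  qed
  let ?E = "\<integral>\<omega>. c (H \<omega>) \<bullet> \<phi> (H \<omega>, S t \<omega>) \<partial>P" and ?c = "\<integral>\<omega>. c (H \<omega>) \<partial>P"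
  have "achievable_means P S SS X \<subseteq> {z. ?E \<le> ?c \<bullet> z}"
  proof
    fix z assume "z \<in> achievable_means P S SS X"
    then obtain \<kappa> where \<kappa>: "randomized_stationary SS X \<kappa>" "z = (\<integral>\<omega>. (\<integral>y. y \<partial>\<kappa> (S t \<omega>)) \<partial>P)"
      unfolding achievable_means_eq[of t] by auto
    note [measurable] = kernel_mean_measurable[OF \<kappa>(1)]
    have "?E \<le> (\<integral>\<omega>. c (H \<omega>) \<bullet> (\<integral>y. y \<partial>\<kappa> (S t \<omega>)) \<partial>P)"
    proof (rule integral_mono)
      fix \<omega> assume \<omega>: "\<omega> \<in> space P"
      have "AE y in \<kappa> (S t \<omega>). c (H \<omega>) \<bullet> \<phi> (H \<omega>, S t \<omega>) \<le> c (H \<omega>) \<bullet> y"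
        using kernel_AE[OF \<kappa>(1) state_mem[OF \<omega>]] 
        by eventually_elim (use min state_mem[OF \<omega>] measurable_space[OF history_measurable \<omega>] in auto)
      then show "c (H \<omega>) \<bullet> \<phi> (H \<omega>, S t \<omega>) \<le> c (H \<omega>) \<bullet> (\<integral>y. y \<partial>\<kappa> (S t \<omega>))"
        by (intro prob_space.expectation_inner_ge[OF kernel_prob_space[OF \<kappa>(1)]]
            kernel_integrable[OF \<kappa>(1)] state_mem[OF \<omega>])
    qed (auto intro!: int_inner decision_mem kernel_mean_mem[OF \<kappa>(1)] state_mem)
    also have "\<dots> = ?c \<bullet> z"
    proof -
      have "indep_var borel (\<lambda>\<omega>. c (H \<omega>)) borel (\<lambda>\<omega>. \<integral>y. y \<partial>\<kappa> (S t \<omega>))"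
        using indep_pair_compose[OF indep c kernel_mean_measurable[OF \<kappa>(1)]]
        by (simp add: indep_var_iff_indep_pair)
      then show ?thesis
        using int_c kernel_mean_integrable[OF \<kappa>(1)] by (simp add: expectation_inner_indep \<kappa>(2))
    qed
    finally show "z \<in> {z. ?E \<le> ?c \<bullet> z}" by simp
  qed
  then have "closure (achievable_means P S SS X) \<subseteq> {z. ?E \<le> ?c \<bullet> z}"
    by (rule closure_minimal) (intro closed_Collect_le continuous_intros)
  then have "?E \<le> ?c \<bullet> z" using z by auto
  moreover have "(\<integral>\<omega>. c (H \<omega>) \<bullet> (\<phi> (H \<omega>, S t \<omega>) - z) \<partial>P) = ?E - ?c \<bullet> z"
    unfolding inner_diff_right using int_c int_inner[of "\<lambda>\<omega>. \<phi> (H \<omega>, S t \<omega>)"] decision_mem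
    by (subst Bochner_Integration.integral_diff) auto
  ultimately show ?thesis by simp
qed

end

end

section \<open>Expected performance of the algorithm\<close>

locale drift_plus_penalty =
  iid_states P S SS X BB + smooth_convex_problem BB f g a b L M K B D
  for P :: "'w measure"
    and S :: "nat \<Rightarrow> 'w \<Rightarrow> 's::second_countable_topology" and SS :: "'s set"
    and X :: "'s \<Rightarrow> 'v::euclidean_space set" and BB :: "'v set"
    and f :: "'v \<Rightarrow> real" and g :: "'v \<Rightarrow> 'v" and a :: "'n::finite \<Rightarrow> 'v" and b :: "'n \<Rightarrow> real"
    and L M K B D :: real +
  fixes V \<eta> :: real and \<phi> :: "nat \<Rightarrow> 'v \<times> (real ^ 'n) \<times> 's \<Rightarrow> 'v" and x :: "nat \<Rightarrow> 'w \<Rightarrow> 'v"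
  assumes V: "0 \<le> V" and \<eta>: "0 < \<eta>" "\<eta> \<le> 1"
    and decision_rules: "\<And>t. decision_rule V g a BB SS X (\<phi> t)"
    and decision: "\<And>t \<omega>. \<omega> \<in> space P \<Longrightarrow>
           x t \<omega> = \<phi> t (gamma_prev \<eta> (\<lambda>k. x k \<omega>) t, vqueue a b (\<lambda>k. x k \<omega>) t, S t \<omega>)"
begin

abbreviation history :: "nat \<Rightarrow> 'w \<Rightarrow> 'v \<times> (real ^ 'n)" where
  "history t \<omega> \<equiv> (gamma_prev \<eta> (\<lambda>k. x k \<omega>) t, vqueue a b (\<lambda>k. x k \<omega>) t)"

abbreviation histories :: "('v \<times> (real ^ 'n)) measure" where
  "histories \<equiv> restrict_space borel (BB \<times> {q. \<forall>i. 0 \<le> q $ i})"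

definition chosen :: "nat \<Rightarrow> ('v \<times> (real ^ 'n)) \<times> 's \<Rightarrow> 'v" where
  "chosen t = (\<lambda>((\<gamma>, q), s). \<phi> t (\<gamma>, q, s))"

lemma space_histories: "space histories = BB \<times> {q. \<forall>i. 0 \<le> q $ i}"
  by (simp add: space_restrict_space)

lemma chosen_optimal:
  assumes "h \<in> space histories" "s \<in> SS"
  shows "chosen t (h, s) \<in> X s"
    and "y \<in> X s \<Longrightarrow> decision_weight V g a (fst h) (snd h) \<bullet> chosen t (h, s)
           \<le> decision_weight V g a (fst h) (snd h) \<bullet> y"
proof -
  obtain \<gamma> q where h: "h = (\<gamma>, q)" by (cases h)
  then have "\<gamma> \<in> BB" "\<And>i. 0 \<le> q $ i" using assms(1) by (auto simp: space_histories)
  then have "is_arg_min (\<lambda>y. decision_weight V g a \<gamma> q \<bullet> y) (\<lambda>y. y \<in> X s) (\<phi> t (\<gamma>, q, s))"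
    using conjunct2[OF decision_rules[of t, unfolded decision_rule_def]] assms(2)
    unfolding decision_weight_inner by blast
  then show "chosen t (h, s) \<in> X s"
    and "y \<in> X s \<Longrightarrow> decision_weight V g a (fst h) (snd h) \<bullet> chosen t (h, s)
           \<le> decision_weight V g a (fst h) (snd h) \<bullet> y"
    by (auto simp: h chosen_def is_arg_min_linorder)
qed

lemma chosen_measurable: "chosen t \<in> borel_measurable (histories \<Otimes>\<^sub>M states)"
proof -
  let ?assoc = "\<lambda>p :: ('v \<times> (real ^ 'n)) \<times> 's. (fst (fst p), snd (fst p), snd p)"
  have assoc: "?assoc \<in> borel_measurable borel"
    by (intro borel_measurable_continuous_onI continuous_intros)
  have 1: "fst \<in> histories \<Otimes>\<^sub>M states \<rightarrow>\<^sub>M borel"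
    using measurable_fst[of histories states] by (rule measurable_restrict_space2_iff[THEN iffD1, THEN conjunct1])
  have 2: "snd \<in> histories \<Otimes>\<^sub>M states \<rightarrow>\<^sub>M borel"
    using measurable_snd[of histories states] by (rule measurable_restrict_space2_iff[THEN iffD1, THEN conjunct1])
  have "(\<lambda>p. (fst p, snd p)) \<in> histories \<Otimes>\<^sub>M states \<rightarrow>\<^sub>M borel \<Otimes>\<^sub>M borel"
    by (rule measurable_Pair[OF 1 2])
  then have "(\<lambda>p. p) \<in> histories \<Otimes>\<^sub>M states \<rightarrow>\<^sub>M borel"
    by (simp only: borel_prod prod.collapse)
  from measurable_compose[OF this assoc]
  have "?assoc \<in> histories \<Otimes>\<^sub>M states \<rightarrow>\<^sub>M restrict_space borel (BB \<times> {q. \<forall>i. 0 \<le> q $ i} \<times> SS)"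
    by (rule measurable_restrict_space2[rotated]) (auto simp: space_pair_measure space_histories)
  then have "(\<lambda>p. \<phi> t (fst (fst p), snd (fst p), snd p)) \<in> borel_measurable (histories \<Otimes>\<^sub>M states)"
    by (rule measurable_compose) (rule conjunct1[OF decision_rules[of t, unfolded decision_rule_def]])
  then show ?thesis unfolding chosen_def case_prod_beta .
qed

lemma decision_eq_chosen: "\<omega> \<in> space P \<Longrightarrow> x t \<omega> = chosen t (history t \<omega>, S t \<omega>)"
  unfolding chosen_def prod.case by (rule decision)

lemma history_mem_iff: "history t \<omega> \<in> space histories \<longleftrightarrow> gamma_prev \<eta> (\<lambda>k. x k \<omega>) t \<in> BB"
  by (simp add: space_histories vqueue_nonneg)

lemma decision_mem_BB: "\<omega> \<in> space P \<Longrightarrow> x t \<omega> \<in> BB"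
proof (induction t rule: less_induct)
  case (less t)
  then have "history t \<omega> \<in> space histories"
    unfolding history_mem_iff using convex zero \<eta> by (intro gamma_prev_mem) auto
  then have "x t \<omega> \<in> X (S t \<omega>)"
    using chosen_optimal(1) state_mem less.prems unfolding decision_eq_chosen[OF less.prems, of t]
    by blast
  then show ?case using options state_mem less.prems by blast
qed

lemma gamma_mem_BB: "\<omega> \<in> space P \<Longrightarrow> gamma_prev \<eta> (\<lambda>k. x k \<omega>) t \<in> BB"
  using convex zero \<eta> decision_mem_BB by (intro gamma_prev_mem) auto

text \<open>
  The current state is known to be independent of the earlier states; to carry this over to the
  history, the history has to be a measurable function of them. The function is built by recursion from the decision
  rules; since these are measurable only on their domain, the target is the restricted space.
\<close>

lemma history_factors_through_past:
  "\<exists>F \<in> PiM {..<t} (\<lambda>_. states) \<rightarrow>\<^sub>M histories.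
     \<forall>\<omega>\<in>space P. F (\<lambda>k\<in>{..<t}. S k \<omega>) = history t \<omega>"
proof (induction t)
  case 0
  have "(\<lambda>_. (0, 0)) \<in> PiM {..<0} (\<lambda>_. states) \<rightarrow>\<^sub>M histories"
    using zero by (intro measurable_const) (simp add: space_histories)
  then show ?case by (rule bexI[rotated]) simp
next
  case (Suc t)
  then obtain F where F: "F \<in> PiM {..<t} (\<lambda>_. states) \<rightarrow>\<^sub>M histories"
    and F_eq: "\<And>\<omega>. \<omega> \<in> space P \<Longrightarrow> F (\<lambda>k\<in>{..<t}. S k \<omega>) = history t \<omega>"
    by blast
  define U where "U p = (case p of ((\<gamma>, q), y) \<Rightarrow>
      ((1 - \<eta>) *\<^sub>R \<gamma> + \<eta> *\<^sub>R y, \<chi> i. max (q $ i + a i \<bullet> y - b i) 0))"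
    for p :: "('v \<times> (real ^ 'n)) \<times> 'v"
  define G where "G \<sigma> = U (F (restrict \<sigma> {..<t}), chosen t (F (restrict \<sigma> {..<t}), \<sigma> t))"
    for \<sigma> :: "nat \<Rightarrow> 's"
  let ?N = "PiM {..<Suc t} (\<lambda>_. states)"
  have U: "U \<in> borel_measurable borel"
    unfolding U_def case_prod_beta
    by (intro borel_measurable_continuous_onI continuous_intros)
  have FN: "(\<lambda>\<sigma>. F (restrict \<sigma> {..<t})) \<in> ?N \<rightarrow>\<^sub>M histories"
    by (rule measurable_compose[OF measurable_restrict_subset F]) auto
  have SN: "(\<lambda>\<sigma>. \<sigma> t) \<in> ?N \<rightarrow>\<^sub>M states"
    by (rule measurable_component_singleton) simp
  have yN: "(\<lambda>\<sigma>. chosen t (F (restrict \<sigma> {..<t}), \<sigma> t)) \<in> borel_measurable ?N"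
    by (rule measurable_compose[OF measurable_Pair[OF FN SN] chosen_measurable])
  have "(\<lambda>\<sigma>. F (restrict \<sigma> {..<t})) \<in> borel_measurable ?N"
    using FN by (rule measurable_restrict_space2_iff[THEN iffD1, THEN conjunct1])
  from measurable_compose[OF borel_measurable_Pair[OF this yN] U]
  have G: "G \<in> borel_measurable ?N" unfolding G_def .
  have G_mem: "G \<sigma> \<in> space histories" if \<sigma>: "\<sigma> \<in> space ?N" for \<sigma>
  proof -
    have F_mem: "F (restrict \<sigma> {..<t}) \<in> space histories"
      by (rule measurable_space[OF FN \<sigma>])
    moreover have "\<sigma> t \<in> SS"
      using measurable_space[OF SN \<sigma>] unfolding space_states .
    then have "chosen t (F (restrict \<sigma> {..<t}), \<sigma> t) \<in> BB"
      using chosen_optimal(1)[OF F_mem] options by blast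
    ultimately show ?thesis
      using \<eta> convex unfolding G_def U_def space_histories
      by (auto split: prod.splits intro!: convexD_alt)
  qed
  have "G \<in> ?N \<rightarrow>\<^sub>M histories"
    by (rule measurable_restrict_space2[OF _ G]) (use G_mem in \<open>simp add: space_histories Pi_def\<close>)
  moreover have "G (\<lambda>k\<in>{..<Suc t}. S k \<omega>) = history (Suc t) \<omega>" if "\<omega> \<in> space P" for \<omega>
  proof -
    have "restrict (\<lambda>k\<in>{..<Suc t}. S k \<omega>) {..<t} = (\<lambda>k\<in>{..<t}. S k \<omega>)" by auto
    then show ?thesis
      using that by (simp add: G_def U_def F_eq decision_eq_chosen[symmetric])
  qed
  ultimately show ?case by blast
qed

lemma history_indep_state: "indep_pair histories (history t) states (S t)"
proof -
  obtain F where F: "F \<in> PiM {..<t} (\<lambda>_. states) \<rightarrow>\<^sub>M histories"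
    and F_eq: "\<And>\<omega>. \<omega> \<in> space P \<Longrightarrow> F (\<lambda>k\<in>{..<t}. S k \<omega>) = history t \<omega>"
    using history_factors_through_past[of t] by blast
  have past_now: "indep_pair (PiM {..<t} (\<lambda>_. states)) (\<lambda>\<omega>. \<lambda>k\<in>{..<t}. S k \<omega>)
      (PiM {t} (\<lambda>_. states)) (\<lambda>\<omega>. \<lambda>k\<in>{t}. S k \<omega>)"
    unfolding indep_var_iff_indep_pair[symmetric]
    by (rule indep_var_restrict[OF indep_states']) auto
  have "(\<lambda>\<sigma>. \<sigma> t) \<in> PiM {t} (\<lambda>_. states) \<rightarrow>\<^sub>M states"
    by (rule measurable_component_singleton) simp
  from indep_pair_compose[OF past_now F this] show ?thesis
    by (rule indep_pair_cong) (simp_all add: F_eq)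
qed

lemma continuous_of_history_measurable:
  "continuous_on (BB \<times> {q. \<forall>i. 0 \<le> q $ i}) h \<Longrightarrow> (\<lambda>\<omega>. h (history t \<omega>)) \<in> borel_measurable P"
  using history_indep_state[of t]
  by (intro measurable_compose[OF _ borel_measurable_continuous_on_restrict])
     (auto simp: indep_pair_def)

lemma continuous_g: "continuous_on BB g"
  using lipschitz by (rule lipschitz_on_continuous_on)

lemma continuous_f: "continuous_on BB f"
  using deriv by (intro differentiable_imp_continuous_on) (auto simp: differentiable_on_def differentiable_def)

lemma continuous_weight:
  "continuous_on (BB \<times> A) (\<lambda>h. decision_weight V g a (fst h) (snd h))"
  unfolding decision_weight_def
  by (intro continuous_intros continuous_on_compose2[OF continuous_g]) auto

lemma decision_measurable [measurable]: "x t \<in> borel_measurable P"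
proof -
  have "(\<lambda>\<omega>. chosen t (history t \<omega>, S t \<omega>)) \<in> borel_measurable P"
    using history_measurable[OF history_indep_state chosen_measurable chosen_optimal(1)]
    by (intro measurable_compose[OF measurable_Pair chosen_measurable] state_measurable)
  then show ?thesis by (subst measurable_cong[OF decision_eq_chosen])
qed

lemma decision_integrable': "integrable P (x t)"
  using decision_mem_BB compact_BB
  by (intro integrable_of_AE_bounded[where A = BB] AE_I2) (auto intro: compact_imp_bounded)

lemma expected_decision_mem: "(\<integral>\<omega>. x t \<omega> \<partial>P) \<in> achievable_means P S SS X"
proof -
  have "(\<integral>\<omega>. x t \<omega> \<partial>P) = (\<integral>\<omega>. chosen t (history t \<omega>, S t \<omega>) \<partial>P)"
    by (intro Bochner_Integration.integral_cong refl decision_eq_chosen)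
  then show ?thesis
    using expected_decision_achievable[OF history_indep_state chosen_measurable chosen_optimal(1)]
    by simp
qed

lemma expected_average_mem:
  assumes "0 < T"
  shows "(\<integral>\<omega>. (1 / real T) *\<^sub>R (\<Sum>t<T. x t \<omega>) \<partial>P) \<in> achievable_means P S SS X"
proof -
  have "(\<integral>\<omega>. (1 / real T) *\<^sub>R (\<Sum>t<T. x t \<omega>) \<partial>P) = (\<Sum>t<T. (1 / real T) *\<^sub>R (\<integral>\<omega>. x t \<omega> \<partial>P))"
    using decision_integrable' by (simp add: scaleR_sum_right)
  also have "\<dots> \<in> achievable_means P S SS X"
    using assms by (intro convex_sum[OF _ convex_achievable_means] expected_decision_mem) auto
  finally show ?thesis .
qed

lemma queue_le: "\<omega> \<in> space P \<Longrightarrow> vqueue a b (\<lambda>k. x k \<omega>) t $ i \<le> real t * \<bar>B\<bar>"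
  using slack_le_abs[OF decision_mem_BB, of \<omega>]
  by (intro vqueue_le) (auto intro: order.trans[OF abs_ge_self])

lemma queue_component_measurable: "(\<lambda>\<omega>. vqueue a b (\<lambda>k. x k \<omega>) t $ i) \<in> borel_measurable P"
  using continuous_of_history_measurable[of "\<lambda>h. snd h $ i" t]
  by (simp add: continuous_on_snd continuous_on_component)

lemma queue_component_integrable: "integrable P (\<lambda>\<omega>. vqueue a b (\<lambda>k. x k \<omega>) t $ i)"
  using queue_le by (intro integrable_const_bound[where B = "real t * \<bar>B\<bar>"] AE_I2
      queue_component_measurable) (simp add: vqueue_nonneg)

lemma queue_component_sq_integrable: "integrable P (\<lambda>\<omega>. (vqueue a b (\<lambda>k. x k \<omega>) t $ i)\<^sup>2)"
  using queue_le by (intro integrable_const_bound[where B = "(real t * \<bar>B\<bar>)\<^sup>2"] AE_I2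
      borel_measurable_power queue_component_measurable) (simp add: vqueue_nonneg power_mono)

lemma queue_norm_sq_integrable: "integrable P (\<lambda>\<omega>. (norm (vqueue a b (\<lambda>k. x k \<omega>) t))\<^sup>2)"
  unfolding norm_vec_sq_eq_sum using queue_component_sq_integrable by simp

definition weight :: "nat \<Rightarrow> 'w \<Rightarrow> 'v" where
  "weight t \<omega> = decision_weight V g a (gamma_prev \<eta> (\<lambda>k. x k \<omega>) t) (vqueue a b (\<lambda>k. x k \<omega>) t)"

lemma weight_bounded:
  assumes "\<omega> \<in> space P"
  shows "norm (weight t \<omega>) \<le> V * M + (\<Sum>i\<in>UNIV. real t * \<bar>B\<bar> * norm (a i))"
proof -
  have "norm (weight t \<omega>) \<le> norm (V *\<^sub>R g (gamma_prev \<eta> (\<lambda>k. x k \<omega>) t))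
      + (\<Sum>i\<in>UNIV. norm ((vqueue a b (\<lambda>k. x k \<omega>) t $ i) *\<^sub>R a i))"
    unfolding weight_def decision_weight_def
    by (intro order.trans[OF norm_triangle_ineq] add_left_mono norm_sum)
  also have "\<dots> \<le> V * M + (\<Sum>i\<in>UNIV. real t * \<bar>B\<bar> * norm (a i))"
    using V assms grad_le[OF gamma_mem_BB[OF assms]] queue_le[OF assms]
    by (intro add_mono sum_mono) (auto intro!: mult_left_mono mult_right_mono simp: vqueue_nonneg)
  finally show ?thesis .
qed

text \<open>
  The only probabilistic input to the bounds: in the mean, the decision at slot \<open>t\<close> is no worse for
  its weight than any limit of achievable points, in particular than the solution.
\<close>

lemma expected_weighted_gap_nonpos:
  assumes "z \<in> closure (achievable_means P S SS X)"
  shows "(\<integral>\<omega>. weight t \<omega> \<bullet> (x t \<omega> - z) \<partial>P) \<le> 0"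
proof -
  have "(\<integral>\<omega>. decision_weight V g a (fst (history t \<omega>)) (snd (history t \<omega>))
      \<bullet> (chosen t (history t \<omega>, S t \<omega>) - z) \<partial>P) \<le> 0"
  proof (rule expected_weighted_decision_le[OF history_indep_state chosen_measurable chosen_optimal(1)])
    show "(\<lambda>h. decision_weight V g a (fst h) (snd h)) \<in> borel_measurable histories"
      by (intro borel_measurable_continuous_on_restrict continuous_weight)
    show "norm (decision_weight V g a (fst (history t \<omega>)) (snd (history t \<omega>)))
        \<le> V * M + (\<Sum>i\<in>UNIV. real t * \<bar>B\<bar> * norm (a i))" if "\<omega> \<in> space P" for \<omega>
      using weight_bounded[OF that] by (simp add: weight_def)
  qed (use chosen_optimal(2) assms in auto)
  moreover have "(\<integral>\<omega>. weight t \<omega> \<bullet> (x t \<omega> - z) \<partial>P)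
      = (\<integral>\<omega>. decision_weight V g a (fst (history t \<omega>)) (snd (history t \<omega>))
          \<bullet> (chosen t (history t \<omega>, S t \<omega>) - z) \<partial>P)"
    by (intro Bochner_Integration.integral_cong refl) (simp add: weight_def decision_eq_chosen[symmetric])
  ultimately show ?thesis by simp
qed

lemma weighted_gap_integrable: "z \<in> BB \<Longrightarrow> integrable P (\<lambda>\<omega>. weight t \<omega> \<bullet> (x t \<omega> - z))"
proof -
  assume z: "z \<in> BB"
  let ?C = "V * M + (\<Sum>i\<in>UNIV. real t * \<bar>B\<bar> * norm (a i))"
  have [measurable]: "weight t \<in> borel_measurable P"
    using continuous_of_history_measurable[OF continuous_weight, of t] by (simp add: weight_def[abs_def])
  have "norm (weight t \<omega> \<bullet> (x t \<omega> - z)) \<le> ?C * D" if "\<omega> \<in> space P" for \<omega>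
  proof -
    have "norm (weight t \<omega> \<bullet> (x t \<omega> - z)) \<le> norm (weight t \<omega>) * norm (x t \<omega> - z)"
      by (simp add: Cauchy_Schwarz_ineq2)
    also have "\<dots> \<le> ?C * D"
      using weight_bounded[OF that, of t] diameter[OF decision_mem_BB[OF that] z]
      by (intro mult_mono) (auto intro: order.trans[OF norm_ge_zero])
    finally show ?thesis .
  qed
  then show ?thesis by (intro integrable_const_bound[where B = "?C * D"] AE_I2) auto
qed

lemma expectation_le_of_pathwise:
  fixes Z :: "'w \<Rightarrow> real"
  assumes z: "z \<in> closure (achievable_means P S SS X)" and Z: "integrable P Z"
    and le: "\<And>\<omega>. \<omega> \<in> space P \<Longrightarrow> Z \<omega> \<le> c + (\<Sum>t<T. weight t \<omega> \<bullet> (x t \<omega> - z))"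
  shows "(\<integral>\<omega>. Z \<omega> \<partial>P) \<le> c"
proof -
  have zB: "z \<in> BB"
    using z closure_minimal[OF achievable_means_subset compact_imp_closed[OF compact_BB]] by blast
  have "(\<integral>\<omega>. Z \<omega> \<partial>P) \<le> (\<integral>\<omega>. c + (\<Sum>t<T. weight t \<omega> \<bullet> (x t \<omega> - z)) \<partial>P)"
    using Z le weighted_gap_integrable[OF zB] by (intro integral_mono) auto
  also have "\<dots> = c + (\<Sum>t<T. \<integral>\<omega>. weight t \<omega> \<bullet> (x t \<omega> - z) \<partial>P)"
    using weighted_gap_integrable[OF zB] by (simp add: prob_space)
  also have "\<dots> \<le> c" using expected_weighted_gap_nonpos[OF z] by (simp add: sum_nonpos)
  finally show ?thesis .
qed

lemma average_mem:
  assumes "\<omega> \<in> space P" "0 < T"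
  shows "(1 / real T) *\<^sub>R (\<Sum>t<T. x t \<omega>) \<in> BB"
  unfolding scaleR_sum_right using assms decision_mem_BB convex
  by (intro convex_sum) auto

lemma objective_integrable:
  assumes "0 < T"
  shows "integrable P (\<lambda>\<omega>. f ((1 / real T) *\<^sub>R (\<Sum>t<T. x t \<omega>)))"
proof -
  have "(\<lambda>\<omega>. (1 / real T) *\<^sub>R (\<Sum>t<T. x t \<omega>)) \<in> P \<rightarrow>\<^sub>M restrict_space borel BB"
    using average_mem[OF _ assms] by (intro measurable_restrict_space2) auto
  then have "(\<lambda>\<omega>. f ((1 / real T) *\<^sub>R (\<Sum>t<T. x t \<omega>))) \<in> borel_measurable P"
    by (rule measurable_compose) (intro borel_measurable_continuous_on_restrict continuous_f)
  then show ?thesis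
    using f_le[OF average_mem[OF _ assms]]
    by (intro integrable_const_bound[where B = K] AE_I2) auto
qed

context
  fixes z :: 'v and T :: nat
  assumes z: "z \<in> closure (achievable_means P S SS X)" and feasible: "\<And>i. a i \<bullet> z \<le> b i"
    and T: "0 < T"
begin

lemma feasible_mem: "z \<in> BB"
  using z closure_minimal[OF achievable_means_subset compact_imp_closed[OF compact_BB]] by blast

lemma pathwise_bound:
  assumes "\<omega> \<in> space P"
  shows "(norm (vqueue a b (\<lambda>k. x k \<omega>) T))\<^sup>2 / 2
      + V * (\<Sum>t<T. f (gamma_prev \<eta> (\<lambda>k. x k \<omega>) t) - f z)
    \<le> 2 * K * V / \<eta> + T * (V * \<eta> * L * D\<^sup>2 / 2 + B\<^sup>2 / 2)
      + (\<Sum>t<T. weight t \<omega> \<bullet> (x t \<omega> - z))"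
  unfolding weight_def
  using decision_mem_BB[OF assms] \<eta> V feasible_mem feasible by (rule drift_plus_penalty_sum)

text \<open>
  The queue term of the pathwise bound is nonnegative and is dropped.
\<close>

lemma expected_objective_le:
  "V * T * ((\<integral>\<omega>. f ((1 / real T) *\<^sub>R (\<Sum>t<T. x t \<omega>)) \<partial>P) - f z)
    \<le> V * M * D / \<eta> + 2 * K * V / \<eta> + T * (V * \<eta> * L * D\<^sup>2 / 2 + B\<^sup>2 / 2)"
proof -
  have "(\<integral>\<omega>. V * T * (f ((1 / real T) *\<^sub>R (\<Sum>t<T. x t \<omega>)) - f z) \<partial>P)
      \<le> V * M * D / \<eta> + 2 * K * V / \<eta> + T * (V * \<eta> * L * D\<^sup>2 / 2 + B\<^sup>2 / 2)"
  proof (rule expectation_le_of_pathwise[OF z])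
    show "integrable P (\<lambda>\<omega>. V * T * (f ((1 / real T) *\<^sub>R (\<Sum>t<T. x t \<omega>)) - f z))"
      using objective_integrable[OF T] by simp
    fix \<omega> assume \<omega>: "\<omega> \<in> space P"
    have "V * (f ((1 / real T) *\<^sub>R (\<Sum>t<T. x t \<omega>)) * T)
        \<le> V * ((\<Sum>t<T. f (gamma_prev \<eta> (\<lambda>k. x k \<omega>) t)) + M * D / \<eta>)"
      using objective_of_average_le[OF decision_mem_BB[OF \<omega>] \<eta> T] V by (rule mult_left_mono)
    then have "V * T * f ((1 / real T) *\<^sub>R (\<Sum>t<T. x t \<omega>))
        \<le> V * (\<Sum>t<T. f (gamma_prev \<eta> (\<lambda>k. x k \<omega>) t)) + V * M * D / \<eta>"
      by (simp add: distrib_left ac_simps)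
    moreover have "V * (\<Sum>t<T. f (gamma_prev \<eta> (\<lambda>k. x k \<omega>) t) - f z)
        = V * (\<Sum>t<T. f (gamma_prev \<eta> (\<lambda>k. x k \<omega>) t)) - V * T * f z"
      by (simp add: sum_subtractf right_diff_distrib)
    moreover have "0 \<le> (norm (vqueue a b (\<lambda>k. x k \<omega>) T))\<^sup>2 / 2" by simp
    ultimately show "V * T * (f ((1 / real T) *\<^sub>R (\<Sum>t<T. x t \<omega>)) - f z)
        \<le> V * M * D / \<eta> + 2 * K * V / \<eta> + T * (V * \<eta> * L * D\<^sup>2 / 2 + B\<^sup>2 / 2)
          + (\<Sum>t<T. weight t \<omega> \<bullet> (x t \<omega> - z))"
      using pathwise_bound[OF \<omega>] unfolding right_diff_distrib by linarith
  qed
  then show ?thesis using objective_integrable[OF T] by (simp add: prob_space)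
qed

text \<open>
  Here the objective term of the pathwise bound is estimated trivially, by \<open>- 2 K\<close> in every slot.
\<close>

lemma expected_queue_norm_sq_le:
  "(\<integral>\<omega>. (norm (vqueue a b (\<lambda>k. x k \<omega>) T))\<^sup>2 \<partial>P)
    \<le> 4 * K * V * T + 4 * K * V / \<eta> + T * (V * \<eta> * L * D\<^sup>2 + B\<^sup>2)"
proof -
  have "(\<integral>\<omega>. (norm (vqueue a b (\<lambda>k. x k \<omega>) T))\<^sup>2 / 2 \<partial>P)
      \<le> 2 * K * V * T + 2 * K * V / \<eta> + T * (V * \<eta> * L * D\<^sup>2 / 2 + B\<^sup>2 / 2)"
  proof (rule expectation_le_of_pathwise[OF z])
    show "integrable P (\<lambda>\<omega>. (norm (vqueue a b (\<lambda>k. x k \<omega>) T))\<^sup>2 / 2)"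
      using queue_norm_sq_integrable by simp
    fix \<omega> assume \<omega>: "\<omega> \<in> space P"
    have "(\<Sum>t<T. - (2 * K)) \<le> (\<Sum>t<T. f (gamma_prev \<eta> (\<lambda>k. x k \<omega>) t) - f z)"
    proof (rule sum_mono)
      fix t
      show "- (2 * K) \<le> f (gamma_prev \<eta> (\<lambda>k. x k \<omega>) t) - f z"
        using f_le[OF gamma_mem_BB[OF \<omega>, of t]] f_le[OF feasible_mem] by linarith
    qed
    from mult_left_mono[OF this V]
    have "- (2 * K * V * T) \<le> V * (\<Sum>t<T. f (gamma_prev \<eta> (\<lambda>k. x k \<omega>) t) - f z)"
      by (simp add: ac_simps)
    then show "(norm (vqueue a b (\<lambda>k. x k \<omega>) T))\<^sup>2 / 2
        \<le> 2 * K * V * T + 2 * K * V / \<eta> + T * (V * \<eta> * L * D\<^sup>2 / 2 + B\<^sup>2 / 2)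
          + (\<Sum>t<T. weight t \<omega> \<bullet> (x t \<omega> - z))"
      using pathwise_bound[OF \<omega>] by linarith
  qed
  then show ?thesis by (simp add: algebra_simps)
qed

text \<open>
  The violation is at most the queue length divided by \<open>T\<close>, whose mean is controlled by the second
  moment.
\<close>

lemma expected_constraint_le:
  "a i \<bullet> (\<integral>\<omega>. (1 / real T) *\<^sub>R (\<Sum>t<T. x t \<omega>) \<partial>P) - b i
    \<le> sqrt (4 * K * V * T + 4 * K * V / \<eta> + T * (V * \<eta> * L * D\<^sup>2 + B\<^sup>2)) / T"
proof -
  let ?Q = "\<lambda>\<omega>. vqueue a b (\<lambda>k. x k \<omega>) T"
  have "a i \<bullet> (\<integral>\<omega>. (1 / real T) *\<^sub>R (\<Sum>t<T. x t \<omega>) \<partial>P) - b i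
      = (\<integral>\<omega>. a i \<bullet> ((1 / real T) *\<^sub>R (\<Sum>t<T. x t \<omega>)) - b i \<partial>P)"
    using decision_integrable' by (simp add: prob_space)
  also have "\<dots> \<le> (\<integral>\<omega>. ?Q \<omega> $ i / T \<partial>P)"
  proof (rule integral_mono)
    fix \<omega>
    have "(\<Sum>k<T. a i \<bullet> x k \<omega>) - T * b i \<le> ?Q \<omega> $ i"
      using vqueue_ge_sum[of a i "\<lambda>k. x k \<omega>" b T] by (simp add: sum_subtractf)
    then have "((\<Sum>k<T. a i \<bullet> x k \<omega>) - T * b i) / T \<le> ?Q \<omega> $ i / T"
      by (rule divide_right_mono) simp
    then show "a i \<bullet> ((1 / real T) *\<^sub>R (\<Sum>t<T. x t \<omega>)) - b i \<le> ?Q \<omega> $ i / T"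
      using T by (simp add: inner_sum_right diff_divide_distrib)
  qed (use decision_integrable' queue_component_integrable in auto)
  also have "\<dots> = (\<integral>\<omega>. ?Q \<omega> $ i \<partial>P) / T" by simp
  also have "\<dots> \<le> sqrt (\<integral>\<omega>. (?Q \<omega> $ i)\<^sup>2 \<partial>P) / T"
  proof (intro divide_right_mono real_le_rsqrt)
    show "(\<integral>\<omega>. ?Q \<omega> $ i \<partial>P)\<^sup>2 \<le> (\<integral>\<omega>. (?Q \<omega> $ i)\<^sup>2 \<partial>P)"
      using variance_positive[of "\<lambda>\<omega>. ?Q \<omega> $ i"]
      by (simp add: variance_eq queue_component_integrable queue_component_sq_integrable)
  qed simp
  also have "\<dots> \<le> sqrt (4 * K * V * T + 4 * K * V / \<eta> + T * (V * \<eta> * L * D\<^sup>2 + B\<^sup>2)) / T"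
  proof (intro divide_right_mono real_sqrt_le_mono order.trans[OF _ expected_queue_norm_sq_le])
    show "(\<integral>\<omega>. (?Q \<omega> $ i)\<^sup>2 \<partial>P) \<le> (\<integral>\<omega>. (norm (?Q \<omega>))\<^sup>2 \<partial>P)"
      using queue_component_sq_integrable queue_norm_sq_integrable
      by (intro integral_mono) (auto simp: norm_vec_sq_eq_sum intro: member_le_sum)
  qed simp
  finally show ?thesis .
qed

text \<open>
  Jensen's inequality, from the tangent plane at the mean.
\<close>

lemma objective_of_expectation_le:
  "f (\<integral>\<omega>. (1 / real T) *\<^sub>R (\<Sum>t<T. x t \<omega>) \<partial>P)
    \<le> (\<integral>\<omega>. f ((1 / real T) *\<^sub>R (\<Sum>t<T. x t \<omega>)) \<partial>P)"
proof -
  let ?xb = "\<lambda>\<omega>. (1 / real T) *\<^sub>R (\<Sum>t<T. x t \<omega>)"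
  define m where "m = (\<integral>\<omega>. ?xb \<omega> \<partial>P)"
  have int: "integrable P ?xb" using decision_integrable' by simp
  have m: "m \<in> BB" using expected_average_mem[OF T] achievable_means_subset unfolding m_def by blast
  have "(\<integral>\<omega>. g m \<bullet> ?xb \<omega> \<partial>P) = g m \<bullet> m"
    unfolding m_def using int by (rule integral_inner_right)
  then have "f m = (\<integral>\<omega>. f m + (g m \<bullet> ?xb \<omega> - g m \<bullet> m) \<partial>P)"
    using integrable_inner_right[OF int, of "g m"]
    by (simp add: prob_space del: inner_scaleR_right)
  also have "\<dots> \<le> (\<integral>\<omega>. f (?xb \<omega>) \<partial>P)"
    using integrable_inner_right[OF int, of "g m"] objective_integrable[OF T]
      convex_above_tangent[OF convex_f m average_mem[OF _ T] deriv]
    by (intro integral_mono) (auto simp: inner_diff_right simp del: inner_scaleR_right)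
  finally show ?thesis unfolding m_def .
qed

end

end

section \<open>Convergence for the choice of the parameters\<close>

theorem corollary3p1:
  fixes P :: "'w measure"
    and S :: "nat \<Rightarrow> 'w \<Rightarrow> real ^ 'm"
    and SS :: "(real ^ 'm) set"
    and X :: "real ^ 'm \<Rightarrow> (real ^ 'd) set"
    and BB :: "(real ^ 'd) set"
    and a :: "'n::finite \<Rightarrow> real ^ 'd"
    and b :: "'n \<Rightarrow> real"
    and f :: "real ^ 'd \<Rightarrow> real"
    and g :: "real ^ 'd \<Rightarrow> real ^ 'd"
    and L M K B D V \<eta> :: real
    and \<gamma>s :: "real ^ 'd"
    and T :: nat
    and \<phi> :: "nat \<Rightarrow> (real ^ 'd) \<times> (real ^ 'n) \<times> (real ^ 'm) \<Rightarrow> real ^ 'd"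
    and x :: "nat \<Rightarrow> 'w \<Rightarrow> real ^ 'd"
  defines "G \<equiv> closure (achievable_means P S SS X)"
    and "xbar \<equiv> (\<lambda>\<omega>. (1 / real T) *\<^sub>R (\<Sum>t<T. x t \<omega>))"
  assumes "prob_space P"
    and "compact BB" and "convex BB"
    and "prob_space.indep_vars P (\<lambda>_. borel) S UNIV"
    and "\<And>t. distr P borel (S t) = distr P borel (S 0)"
    and "\<And>t \<omega>. \<omega> \<in> space P \<Longrightarrow> S t \<omega> \<in> SS"
    and "\<And>s. s \<in> SS \<Longrightarrow> X s \<noteq> {} \<and> compact (X s) \<and> X s \<subseteq> BB"
    and "0 \<in> G"
    and "\<And>y. y \<in> BB \<Longrightarrow> (f has_derivative (\<lambda>h. g y \<bullet> h)) (at y within BB)"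
    and "L-lipschitz_on BB g"
    and "\<And>y. y \<in> BB \<Longrightarrow> norm (g y) \<le> M"
    and "\<And>y. y \<in> BB \<Longrightarrow> \<bar>f y\<bar> \<le> K"
    and "\<And>y. y \<in> BB \<Longrightarrow> (\<Sum>i\<in>UNIV. \<bar>a i \<bullet> y - b i\<bar>\<^sup>2) \<le> B\<^sup>2"
    and "\<And>y z. y \<in> BB \<Longrightarrow> z \<in> BB \<Longrightarrow> norm (y - z) \<le> D"
    and "convex_on BB f"
    and "is_solution f a b G \<gamma>s"
    and "T > 1"
    and "V = real T powr (1/3)"
    and "\<eta> = real T powr (-2/3)"
    and "\<And>t. decision_rule V g a BB SS X (\<phi> t)"
    and "\<And>t \<omega>. \<omega> \<in> space P \<Longrightarrow>
           x t \<omega> = \<phi> t (gamma_prev \<eta> (\<lambda>k. x k \<omega>) t, vqueue a b (\<lambda>k. x k \<omega>) t, S t \<omega>)"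
  shows "(\<integral>\<omega>. f (xbar \<omega>) \<partial>P) \<le> f \<gamma>s +
           (2 * K + M * D + B\<^sup>2 / 2 + L * D\<^sup>2 / (2 * real T powr (1/3))) * (1 / real T powr (1/3))
       \<and> f (\<integral>\<omega>. xbar \<omega> \<partial>P) \<le> f \<gamma>s +
           (2 * K + M * D + B\<^sup>2 / 2 + L * D\<^sup>2 / (2 * real T powr (1/3))) * (1 / real T powr (1/3))
       \<and> (\<forall>i. a i \<bullet> (\<integral>\<omega>. xbar \<omega> \<partial>P) - b i \<le>
           sqrt (4 * K + 4 * K / real T powr (1/3) + B\<^sup>2 / real T powr (1/3)
                 + L * D\<^sup>2 / real T powr (2/3)) * (1 / real T powr (1/3)))
       \<and> (\<forall>\<epsilon>. 0 < \<epsilon> \<and> \<epsilon> \<le> 1 \<and> real T \<ge> conv_const K M D B L / \<epsilon> ^ 3 \<longrightarrow>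
           near_optimal f a b G \<gamma>s \<epsilon> (\<integral>\<omega>. xbar \<omega> \<partial>P))"
proof -
  interpret prob_space P by fact
  interpret states: iid_states P S SS X BB
    by unfold_locales fact+
  have "0 \<in> BB"
    using \<open>0 \<in> G\<close> closure_minimal[OF states.achievable_means_subset compact_imp_closed[OF \<open>compact BB\<close>]]
    unfolding G_def by blast
  (* All bounds are rational functions of the cube root of T: V = r, eta = r^(-2), T = r^3. *)
  define r where "r = real T powr (1/3)"
  have r: "1 \<le> r" using \<open>T > 1\<close> by (simp add: r_def ge_one_powr_ge_zero)
  have r3: "real T = r ^ 3" and r2: "real T powr (2/3) = r\<^sup>2"
    using \<open>T > 1\<close> by (simp_all add: r_def powr_power)
  have V_eq: "V = r" and \<eta>_eq: "\<eta> = 1 / r\<^sup>2"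
    using assms(20,21) r2 by (simp_all add: r_def powr_minus_divide)
  interpret drift_plus_penalty P S SS X BB f g a b L M K B D V \<eta> \<phi> x
  proof unfold_locales
    show "0 \<le> V" "0 < \<eta>" "\<eta> \<le> 1" using r by (simp_all add: V_eq \<eta>_eq)
  qed fact+
  have T: "0 < T" using \<open>T > 1\<close> by simp
  have \<gamma>s: "\<gamma>s \<in> closure (achievable_means P S SS X)" and feas: "\<And>i. a i \<bullet> \<gamma>s \<le> b i"
    using \<open>is_solution f a b G \<gamma>s\<close> by (auto simp: is_solution_def is_arg_min_def G_def)
  define e1 where "e1 = 2 * K + M * D + B\<^sup>2 / 2 + L * D\<^sup>2 / (2 * r)"
  define e2 where "e2 = sqrt (4 * K + 4 * K / r + B\<^sup>2 / r + L * D\<^sup>2 / r\<^sup>2)"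

  have "V * T * ((\<integral>\<omega>. f (xbar \<omega>) \<partial>P) - f \<gamma>s)
      \<le> V * M * D / \<eta> + 2 * K * V / \<eta> + T * (V * \<eta> * L * D\<^sup>2 / 2 + B\<^sup>2 / 2)"
    using expected_objective_le[OF \<gamma>s feas T] unfolding xbar_def .
  also have "\<dots> = r * r ^ 3 * (e1 * (1 / r))"
    using r unfolding V_eq \<eta>_eq r3 by (simp add: e1_def field_simps eval_nat_numeral)
  finally have "r * r ^ 3 * ((\<integral>\<omega>. f (xbar \<omega>) \<partial>P) - f \<gamma>s) \<le> r * r ^ 3 * (e1 * (1 / r))"
    unfolding V_eq r3 .
  then have objective: "(\<integral>\<omega>. f (xbar \<omega>) \<partial>P) \<le> f \<gamma>s + e1 * (1 / r)"
    using r by (subst (asm) mult_le_cancel_left_pos) auto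
  then have objective': "f (\<integral>\<omega>. xbar \<omega> \<partial>P) \<le> f \<gamma>s + e1 * (1 / r)"
    using objective_of_expectation_le[OF \<gamma>s feas T] unfolding xbar_def by linarith
  have constraint: "a i \<bullet> (\<integral>\<omega>. xbar \<omega> \<partial>P) - b i \<le> e2 * (1 / r)" for i
  proof -
    have "4 * K * r * r ^ 3 + 4 * K * r / (1 / r\<^sup>2) + r ^ 3 * (r * (1 / r\<^sup>2) * L * D\<^sup>2 + B\<^sup>2)
        = (r\<^sup>2)\<^sup>2 * (4 * K + 4 * K / r + B\<^sup>2 / r + L * D\<^sup>2 / r\<^sup>2)"
      using r by (simp add: field_simps eval_nat_numeral)
    then have "sqrt (4 * K * r * r ^ 3 + 4 * K * r / (1 / r\<^sup>2) + r ^ 3 * (r * (1 / r\<^sup>2) * L * D\<^sup>2 + B\<^sup>2))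
        = r\<^sup>2 * e2"
      by (simp only: real_sqrt_mult real_sqrt_abs e2_def) simp
    then have "a i \<bullet> (\<integral>\<omega>. xbar \<omega> \<partial>P) - b i \<le> r\<^sup>2 * e2 / r ^ 3"
      using expected_constraint_le[OF \<gamma>s feas T, of i] unfolding V_eq \<eta>_eq r3 xbar_def by (simp only:)
    also have "\<dots> = e2 * (1 / r)" using r by (simp add: field_simps eval_nat_numeral)
    finally show ?thesis .
  qed
  have near: "near_optimal f a b G \<gamma>s \<epsilon> (\<integral>\<omega>. xbar \<omega> \<partial>P)"
    if \<epsilon>: "0 < \<epsilon>" and large: "real T \<ge> conv_const K M D B L / \<epsilon> ^ 3" for \<epsilon>
  proof -
    define c where "c = max (2 * K + M * D + B\<^sup>2 / 2 + L * D\<^sup>2 / 2) (sqrt (8 * K + B\<^sup>2 + L * D\<^sup>2))"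
    note nonneg = constants_nonneg
    have "c ^ 3 \<le> (\<epsilon> * r) ^ 3"
      using large \<epsilon> by (simp add: conv_const_def c_def r3 field_simps)
    then have c: "c \<le> \<epsilon> * r"
      using \<epsilon> r by (intro power_le_imp_le_base[of c 2]) auto
    (* Since r is at least 1, replacing r by 1 in the denominators only enlarges the error terms;
       this is how the constant arises. *)
    have div_r: "u / r \<le> u" "u / r\<^sup>2 \<le> u" if "0 \<le> u" for u
      using that r by (auto intro!: divide_left_mono[of 1 _ u, simplified] simp: one_le_power)
    have "e1 \<le> c"
      using div_r(1)[of "L * D\<^sup>2 / 2"] nonneg by (simp add: e1_def c_def)
    moreover have "e2 \<le> c"
    proof -
      have "4 * K + 4 * K / r + B\<^sup>2 / r + L * D\<^sup>2 / r\<^sup>2 \<le> 8 * K + B\<^sup>2 + L * D\<^sup>2"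
        using div_r(1)[of "4 * K"] div_r(1)[of "B\<^sup>2"] div_r(2)[of "L * D\<^sup>2"] nonneg by simp
      then show ?thesis unfolding e2_def c_def by (intro max.coboundedI2 real_sqrt_le_mono)
    qed
    ultimately have "e1 * (1 / r) \<le> \<epsilon>" "e2 * (1 / r) \<le> \<epsilon>"
      using c r by (simp_all add: divide_le_eq)
    moreover have "(\<integral>\<omega>. xbar \<omega> \<partial>P) \<in> G"
      using expected_average_mem[OF T] closure_subset unfolding G_def xbar_def by blast
    ultimately show ?thesis
      using objective' constraint unfolding near_optimal_def by (meson add_left_mono order.trans)
  qed
  show ?thesis
    using objective objective' constraint near
    unfolding e1_def e2_def r2 r_def[symmetric] by blast
qed

end
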